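(* Let $C$ be a copula and let $\Pi=(\Pi_n)_{n\in\mathbb{N}}$ be the permutation sequence generated by $C$. Regard $\Pi$ as a process on its minimal state space $S_C=\{\pi\in\mathbb{S}:\ t(\pi,C)>0\}$ (note $P(\Pi_k=\sigma)=t(\sigma,C)$ for $\sigma\in\mathbb{S}_k$). Then: (i) $\Pi$ is a Markov chain with transition probabilities $$P(\Pi_{n+1}=\tau\mid\Pi_n=\sigma)=\frac{(n+1)\,t(\tau,C)}{t(\sigma,C)}\,p^{\mathrm H}(\sigma,\tau),\qquad n\in\mathbb{N},\ \sigma\in\mathbb{S}_n\cap S_C,\ \tau\in\mathbb{S}_{n+1},$$ where $p^{\mathrm H}(\sigma,\tau)=P(\Pi^{\mathrm H}_{n+1}=\tau\mid\Pi^{\mathrm H}_n=\sigma)$ is the one-step transition function of the double-insertion chain $\Pi^{\mathrm H}$. (ii) The Doob–Martin topology associated with $\Pi$ coincides with the pattern frequency topology (on $S_C$). (iii) $\Pi$ is a Doob $h$-transform of $\Pi^{\mathrm H}$: with $K$ the Martin kernel of $\Pi^{\mathrm H}$, continuously extended to the boundary point identified with $C$, $$P(\Pi_{n+1}=\tau\mid\Pi_n=\sigma)=\frac{K(\tau,C)}{K(\sigma,C)}\,P(\Pi^{\mathrm H}_{n+1}=\tau\mid\Pi^{\mathrm H}_n=\sigma)$$ for all $n\in\mathbb{N}$, $\sigma\in\mathbb{S}_n\cap S_C$, $\tau\in\mathbb{S}_{n+1}$.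
   Context: $\mathbb{S}_n$ is the set of permutations of $[n]$ in one-line notation, $\mathbb{S}=\bigsqcup_{n\ge1}\mathbb{S}_n$, and $|\pi|=n$ for $\pi\in\mathbb{S}_n$. Pattern frequency: for $\sigma\in\mathbb{S}_k$, $\pi\in\mathbb{S}_n$, $k\le n$, $t(\sigma,\pi)$ is the fraction of the $\binom nk$ subsets $\{i_1<\dots<i_k\}\subset[n]$ such that $\sigma(j)<\sigma(m)\Leftrightarrow\pi(i_j)<\pi(i_m)$ for all $j,m\in[k]$; $t(\sigma,\pi)=0$ if $k>n$. A copula is the distribution function of a probability measure on $[0,1]^2$ with uniform marginals. For data $(x_1,y_1),\dots,(x_n,y_n)$ without ties in either coordinate, with $\pi_x(i)=\#\{j:x_j\le x_i\}$, $\pi_y(i)=\#\{j:y_j\le y_i\}$, the associated permutation is $\pi_y\circ\pi_x^{-1}$. The permutation sequence generated by $C$: $(X_i,Y_i)_{i\in\mathbb{N}}$ i.i.d. with distribution function $C$, $\Pi_n$ = permutation associated with the first $n$ pairs. For $\sigma\in\mathbb{S}_k$, $t(\sigma,C)$ is the probability that $k$ i.i.d. points from $C$ have associated permutation $\sigma$. The chain $\Pi^{\mathrm H}$: $\Pi^{\mathrm H}_1=(1)$; from $\Pi^{\mathrm H}_n$, draw $I,J$ independent uniform on $[n+1]$ (independent of the past), insert the value $J$ at position $I$ of the one-line notation and increase by one all old values $\ge J$. Compactification by functions: given a countable family $\mathcal F$ of functions $S\to[0,1]$ separating points of a countable set $S$, embed $S$ into $[0,1]^{\mathcal F}$ (product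 topology) by $x\mapsto(f(x))_{f\in\mathcal F}$ and take the closure; a sequence converges iff $f(x_n)$ converges for all $f\in\mathcal F$. The pattern frequency topology uses $\mathcal F=\{\pi\mapsto t(\sigma,\pi):\sigma\in\mathbb{S}\}$; copulas are identified with boundary points via $\sigma\mapsto t(\sigma,C)$. For a Markov chain $(X_n)$ with $X_n\in S_n$ and $P(X_n=x)>0$ for all $x\in S_n$, the Doob–Martin topology uses $\mathcal F=\{f_x:x\in S\}$, $f_x(y)=P(X_m=x\mid X_n=y)$ for $x\in S_m$, $y\in S_n$, $n\ge m$, and $f_x(y)=0$ if $n<m$. The Martin kernel is $K(x,y)=P(X_n=y\mid X_m=x)/P(X_n=y)$ for $x\in S_m,y\in S_n$, $n\ge m$, and $0$ otherwise; it extends continuously in the second argument to the boundary, $K(x,\alpha)=\lim K(x,y_n)$ for $y_n\to\alpha$. *)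

theory Defs
  imports "HOL-Probability.Probability"
begin

definition perms :: "nat \<Rightarrow> nat list set" where
  "perms n = {xs. length xs = n \<and> distinct xs \<and> set xs = {1..n}}"

definition allperms :: "nat list set" where
  "allperms = {xs. \<exists>n\<ge>1. xs \<in> perms n}"

definition occurs_at :: "nat list \<Rightarrow> nat list \<Rightarrow> nat set \<Rightarrow> bool" where
  "occurs_at \<sigma> \<pi> I = (let is = sorted_list_of_set I in
     \<forall>j < length \<sigma>. \<forall>m < length \<sigma>. (\<sigma> ! j < \<sigma> ! m \<longleftrightarrow> \<pi> ! (is ! j) < \<pi> ! (is ! m)))"

definition t_perm :: "nat list \<Rightarrow> nat list \<Rightarrow> real" where
  "t_perm \<sigma> \<pi> =
     (if length \<sigma> \<le> length \<pi> then
        real (card {I. I \<subseteq> {..<length \<pi>} \<and> card I = length \<sigma> \<and> occurs_at \<sigma> \<pi> I})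
        / real (length \<pi> choose length \<sigma>)
      else 0)"

text \<open>A probability measure on the Borel sets of the plane with uniform marginals
  (hence concentrated on the unit square).\<close>
definition copula_measure :: "(real \<times> real) measure \<Rightarrow> bool" where
  "copula_measure \<mu> \<longleftrightarrow> prob_space \<mu> \<and> sets \<mu> = sets borel \<and>
     (\<forall>x\<in>{0..1}. measure \<mu> ({..x} \<times> UNIV) = x \<and> measure \<mu> (UNIV \<times> {..x}) = x) \<and>
     measure \<mu> ({0..1} \<times> {0..1}) = 1"

definition no_ties :: "nat \<Rightarrow> (nat \<Rightarrow> real \<times> real) \<Rightarrow> bool" where
  "no_ties n p \<longleftrightarrow> inj_on (fst \<circ> p) {..<n} \<and> inj_on (snd \<circ> p) {..<n}"

definition rank_x :: "(nat \<Rightarrow> real \<times> real) \<Rightarrow> nat \<Rightarrow> nat \<Rightarrow> nat" where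
  "rank_x p n i = card {j\<in>{..<n}. fst (p j) \<le> fst (p i)}"

definition rank_y :: "(nat \<Rightarrow> real \<times> real) \<Rightarrow> nat \<Rightarrow> nat \<Rightarrow> nat" where
  "rank_y p n i = card {j\<in>{..<n}. snd (p j) \<le> snd (p i)}"

text \<open>One-line notation of pi_y o pi_x^{-1} for the data p 0, ..., p (n-1).\<close>
definition assoc_perm :: "nat \<Rightarrow> (nat \<Rightarrow> real \<times> real) \<Rightarrow> nat list" where
  "assoc_perm n p = map (\<lambda>r. rank_y p n (THE i. i < n \<and> rank_x p n i = r)) [1..<n+1]"

definition t_cop :: "(real \<times> real) measure \<Rightarrow> nat list \<Rightarrow> real" where
  "t_cop \<mu> \<sigma> = (let k = length \<sigma>; M = PiM {..<k} (\<lambda>_. \<mu>) in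
     measure M {p \<in> space M. no_ties k p \<and> assoc_perm k p = \<sigma>})"

text \<open>The i.i.d. sample space and the permutation sequence (defined on the null set of
  ties as the empty list, which is not a permutation).\<close>
definition iid :: "(real \<times> real) measure \<Rightarrow> (nat \<Rightarrow> real \<times> real) measure" where
  "iid \<mu> = PiM UNIV (\<lambda>_. \<mu>)"

definition PiSeq :: "nat \<Rightarrow> (nat \<Rightarrow> real \<times> real) \<Rightarrow> nat list" where
  "PiSeq n \<omega> = (if no_ties n \<omega> then assoc_perm n \<omega> else [])"

definition state_space :: "(real \<times> real) measure \<Rightarrow> nat list set" where
  "state_space \<mu> = {\<pi> \<in> allperms. t_cop \<mu> \<pi> > 0}"

definition probPi :: "(real \<times> real) measure \<Rightarrow> nat list \<Rightarrow> real" where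
  "probPi \<mu> y = measure (iid \<mu>) {\<omega> \<in> space (iid \<mu>). PiSeq (length y) \<omega> = y}"

definition probPi2 :: "(real \<times> real) measure \<Rightarrow> nat list \<Rightarrow> nat list \<Rightarrow> real" where
  "probPi2 \<mu> x y = measure (iid \<mu>)
     {\<omega> \<in> space (iid \<mu>). PiSeq (length x) \<omega> = x \<and> PiSeq (length y) \<omega> = y}"

definition transPi :: "(real \<times> real) measure \<Rightarrow> nat list \<Rightarrow> nat list \<Rightarrow> real" where
  "transPi \<mu> \<sigma> \<tau> = probPi2 \<mu> \<sigma> \<tau> / probPi \<mu> \<sigma>"

definition fDM :: "(real \<times> real) measure \<Rightarrow> nat list \<Rightarrow> nat list \<Rightarrow> real" where
  "fDM \<mu> x y = (if length x \<le> length y then probPi2 \<mu> x y / probPi \<mu> y else 0)"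

definition ins :: "nat list \<Rightarrow> nat \<Rightarrow> nat \<Rightarrow> nat list" where
  "ins \<sigma> i j = (let \<sigma>' = map (\<lambda>v. if j \<le> v then v + 1 else v) \<sigma>
                 in take (i - 1) \<sigma>' @ j # drop (i - 1) \<sigma>')"

text \<open>p^H(sigma,tau): I, J independent uniform on [n+1].\<close>
definition pH :: "nat list \<Rightarrow> nat list \<Rightarrow> real" where
  "pH \<sigma> \<tau> = (let n = length \<sigma> in
     real (card {(i, j). i \<in> {1..n+1} \<and> j \<in> {1..n+1} \<and> ins \<sigma> i j = \<tau>}) / real ((n + 1)^2))"

fun transH :: "nat \<Rightarrow> nat list \<Rightarrow> nat list \<Rightarrow> real" where
  "transH 0 x y = (if x = y then 1 else 0)"
| "transH (Suc k) x y = (\<Sum>z\<in>perms (length x + k). transH k x z * pH z y)"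

definition probH :: "nat list \<Rightarrow> real" where
  "probH y = transH (length y - 1) [1] y"

definition KH :: "nat list \<Rightarrow> nat list \<Rightarrow> real" where
  "KH x y = (if length x \<le> length y then transH (length y - length x) x y / probH y else 0)"

end

theory Submission
  imports Defs
begin

text \<open>
  By exchangeability of the sample, given that the first n points have pattern y, each of the
  n choose m sets of m points among them is equally likely to be the set of the first m points;
  hence P(\<Pi>(m) = x, \<Pi>(n) = y) = t(x, y) t(y, C). The same averaging works on any event that is
  invariant under permuting the first n points, and iterating it shows that a path probability is
  a product of pattern frequencies times the probability of the last permutation; this is the
  Markov property. Inserting a value is inverse to deleting a position, so
  pH(\<sigma>, \<tau>) = t(\<sigma>, \<tau>) / (n + 1), and averaging pattern frequencies over an intermediate level
  gives the Martin kernel K(x, y) = m! t(x, y) of the double-insertion chain. Both topologies are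
  therefore governed by the same functions t(x, _), except for those x with t(x, C) = 0, which
  never occur in an element of the state space.
\<close>

section \<open>Patterns of finite point sets\<close>

text \<open>The permutation associated with the points (X a, Y a) for a in S. The associated permutation of
  data and the pattern of a permutation at a set of positions are both instances.\<close>
definition pat :: "('a \<Rightarrow> 'b::linorder) \<Rightarrow> ('a \<Rightarrow> 'c::linorder) \<Rightarrow> 'a set \<Rightarrow> nat list" where
  "pat X Y S = map (\<lambda>r. card {b\<in>S. Y b \<le> Y (THE a. a \<in> S \<and> card {b\<in>S. X b \<le> X a} = r)}) [1..<card S + 1]"

text \<open>The equivalence between the order of the X-values and the order of the indices makes X
  injective on S, so an enumeration also certifies that there are no ties in X.\<close>

definition increasing_enum :: "('a \<Rightarrow> 'b::linorder) \<Rightarrow> 'a set \<Rightarrow> (nat \<Rightarrow> 'a) \<Rightarrow> bool" where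
  "increasing_enum X S e \<longleftrightarrow> bij_betw e {..<card S} S \<and> (\<forall>i<card S. \<forall>j<card S. X (e i) < X (e j) \<longleftrightarrow> i < j)"

text \<open>Sort the values of X on S and pull the sorted list back along the inverse of X.\<close>

lemma enum_exists:
  assumes "finite S" "inj_on X S"
  obtains e where "increasing_enum X S e"
proof -
  define xs where "xs = sorted_list_of_set (X ` S)"
  have len: "length xs = card S" and dist: "distinct xs" and setxs: "set xs = X ` S"
    using assms by (auto simp: xs_def card_image)
  have ord: "xs ! i < xs ! j \<longleftrightarrow> i < j" if "i < card S" "j < card S" for i j
  proof -
    have "sorted_wrt (<) xs" by (simp add: xs_def)
    then show ?thesis using that len
      by (metis linorder_neqE_nat not_less_iff_gr_or_eq sorted_wrt_iff_nth_less)
  qed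
  have "bij_betw ((!) xs) {..<card S} (X ` S)"
    using len dist setxs by (simp add: bij_betw_nth)
  moreover have "bij_betw (inv_into S X) (X ` S) S"
    using assms(2) by (simp add: bij_betw_inv_into inj_on_imp_bij_betw)
  ultimately have "bij_betw (inv_into S X \<circ> (!) xs) {..<card S} S"
    by (rule bij_betw_trans)
  moreover have "X ((inv_into S X \<circ> (!) xs) i) = xs ! i" if "i < card S" for i
  proof -
    have "xs ! i \<in> X ` S" using that len setxs nth_mem by metis
    then show ?thesis by (simp add: f_inv_into_f)
  qed
  ultimately have "increasing_enum X S (inv_into S X \<circ> (!) xs)"
    using ord by (simp add: increasing_enum_def)
  then show ?thesis by (rule that)
qed

lemma enum_inj_on:
  assumes "increasing_enum X S e"
  shows "inj_on X S"
proof (rule inj_onI)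
  fix a b assume "a \<in> S" "b \<in> S" "X a = X b"
  moreover have "e ` {..<card S} = S" using assms by (auto simp: increasing_enum_def bij_betw_def)
  ultimately obtain i j where "i < card S" "j < card S" "a = e i" "b = e j" by blast
  with \<open>X a = X b\<close> assms show "a = b" 
    by (metis increasing_enum_def less_irrefl linorder_neqE_nat)
qed

text \<open>The point \<open>e i\<close> is the unique one of X-rank \<open>Suc i\<close>
  (enumerations start at 0, ranks at 1), so the definite description inside \<open>pat\<close> can
  be replaced by \<open>e i\<close>.\<close>

lemma pat_enum:
  assumes e: "increasing_enum X S e" 
  shows "pat X Y S = map (\<lambda>i. card {b\<in>S. Y b \<le> Y (e i)}) [0..<card S]"
proof -
  have bij: "bij_betw e {..<card S} S" using e by (simp add: increasing_enum_def)
  then have S: "e ` {..<card S} = S" and inj: "inj_on e {..<card S}" by (auto simp: bij_betw_def)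
  have rank: "card {b\<in>S. X b \<le> X (e i)} = Suc i" if "i < card S" for i
  proof -
    have "{b\<in>S. X b \<le> X (e i)} = e ` {..i}"
    proof -
      have "X (e j) \<le> X (e i) \<longleftrightarrow> j \<le> i" if "j < card S" for j
        using e that \<open>i < card S\<close> by (auto simp: increasing_enum_def simp flip: not_less)
      moreover have "{b\<in>S. X b \<le> X (e i)} = e ` {j\<in>{..<card S}. X (e j) \<le> X (e i)}"
        using S by auto
      moreover have "{j\<in>{..<card S}. X (e j) \<le> X (e i)} = {..i}"
        using calculation(1) that by auto
      ultimately show ?thesis by simp
    qed
    moreover have "inj_on e {..i}" using inj that by (auto intro: inj_on_subset)
    ultimately show ?thesis by (simp add: card_image)
  qed
  have "(THE a. a \<in> S \<and> card {b\<in>S. X b \<le> X a} = Suc i) = e i" if "i < card S" for i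
  proof (rule the_equality)
    show "e i \<in> S \<and> card {b \<in> S. X b \<le> X (e i)} = Suc i" using S rank that by blast
    fix a assume a: "a \<in> S \<and> card {b \<in> S. X b \<le> X a} = Suc i"
    then obtain j where "j < card S" "a = e j" using S by blast
    with a rank[of j] show "a = e i" by auto
  qed
  then show ?thesis by (auto simp: pat_def simp del: upt_Suc intro!: nth_equalityI)
qed

lemma rank_less_iff:
  assumes "finite S" "a \<in> S" "c \<in> S"
  shows "card {b\<in>S. Y b \<le> Y a} < card {b\<in>S. Y b \<le> (Y c :: 'b :: linorder)} \<longleftrightarrow> Y a < Y c"
proof
  assume "Y a < Y c"
  then have "{b\<in>S. Y b \<le> Y a} \<subset> {b\<in>S. Y b \<le> Y c}" using assms by force
  then show "card {b\<in>S. Y b \<le> Y a} < card {b\<in>S. Y b \<le> Y c}"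
    using assms by (intro psubset_card_mono) auto
next
  assume *: "card {b\<in>S. Y b \<le> Y a} < card {b\<in>S. Y b \<le> Y c}"
  show "Y a < Y c"
  proof (rule ccontr)
    assume "\<not> Y a < Y c"
    then have "{b\<in>S. Y b \<le> Y c} \<subseteq> {b\<in>S. Y b \<le> Y a}" by auto
    then have "card {b\<in>S. Y b \<le> Y c} \<le> card {b\<in>S. Y b \<le> Y a}"
      using assms by (intro card_mono) auto
    with * show False by simp
  qed
qed

lemma length_pat [simp]: "length (pat X Y S) = card S"
  by (simp add: pat_def)

lemma pat_less_iff:
  assumes "finite S" "increasing_enum X S e" "i < card S" "j < card S"
  shows "pat X Y S ! i < pat X Y S ! j \<longleftrightarrow> Y (e i) < Y (e j)"
proof -
  have "e i \<in> S" "e j \<in> S" using assms by (auto simp: increasing_enum_def bij_betw_def)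
  then show ?thesis using assms by (simp add: pat_enum rank_less_iff)
qed

lemma pat_perms:
  assumes "finite S" "inj_on X S" "inj_on Y S"
  shows "pat X Y S \<in> perms (card S)"
proof -
  obtain e where e: "increasing_enum X S e" using assms enum_exists by blast
  then have bij: "bij_betw e {..<card S} S" by (simp add: increasing_enum_def)
  have "distinct (pat X Y S)"
    unfolding distinct_conv_nth
  proof (intro allI impI)
    fix i j assume "i < length (pat X Y S)" "j < length (pat X Y S)" "i \<noteq> j"
    then have ij: "i < card S" "j < card S" by auto
    then have "e i \<noteq> e j" "e i \<in> S" "e j \<in> S" using bij \<open>i \<noteq> j\<close> by (auto simp: bij_betw_def inj_on_def)
    then have "Y (e i) \<noteq> Y (e j)" using assms(3) by (auto simp: inj_on_def)
    then show "pat X Y S ! i \<noteq> pat X Y S ! j"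
      using pat_less_iff[OF assms(1) e, of i j] pat_less_iff[OF assms(1) e, of j i] ij
      by (metis less_irrefl linorder_less_linear)
  qed
  moreover have "set (pat X Y S) \<subseteq> {1..card S}"
  proof -
    have "card {b\<in>S. Y b \<le> Y (e i)} \<in> {1..card S}" if "i < card S" for i
    proof -
      have "e i \<in> S" using that bij by (auto simp: bij_betw_def)
      then have "card {b\<in>S. Y b \<le> Y (e i)} > 0" using assms(1) by (auto simp: card_gt_0_iff)
      moreover have "card {b\<in>S. Y b \<le> Y (e i)} \<le> card S" using assms(1) by (intro card_mono) auto
      ultimately show ?thesis by simp
    qed
    then show ?thesis by (auto simp: pat_enum[OF e])
  qed
  ultimately have "set (pat X Y S) = {1..card S}"
    by (intro card_subset_eq) (auto simp: distinct_card)
  with \<open>distinct (pat X Y S)\<close> show ?thesis by (simp add: perms_def)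
qed

section \<open>Permutations in one-line notation and their subpatterns\<close>

lemma perms_bij_betw:
  assumes "\<sigma> \<in> perms n"
  shows "bij_betw ((!) \<sigma>) {..<n} {1..n}"
  using assms by (auto simp: perms_def intro!: bij_betw_nth)

lemma perms_rank:
  assumes "\<sigma> \<in> perms n" "v \<in> {1..n}"
  shows "card {j\<in>{..<n}. \<sigma> ! j \<le> v} = v"
proof -
  have bij: "bij_betw ((!) \<sigma>) {..<n} {1..n}" by (rule perms_bij_betw[OF assms(1)])
  have "(!) \<sigma> ` {j\<in>{..<n}. \<sigma> ! j \<le> v} = {1..v}"
  proof -
    have "(!) \<sigma> ` {j\<in>{..<n}. \<sigma> ! j \<le> v} = (!) \<sigma> ` {..<n} \<inter> {..v}" by auto
    also have "\<dots> = {1..v}" using bij assms(2) by (auto simp: bij_betw_def)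
    finally show ?thesis .
  qed
  moreover have "inj_on ((!) \<sigma>) {j\<in>{..<n}. \<sigma> ! j \<le> v}"
    using bij by (auto simp: bij_betw_def intro: inj_on_subset)
  ultimately show ?thesis using card_image by fastforce
qed

lemma perms_nth_mem: "\<sigma> \<in> perms n \<Longrightarrow> i < n \<Longrightarrow> \<sigma> ! i \<in> {1..n}"
  by (metis bij_betwE lessThan_iff perms_bij_betw)

lemma perms_length: "\<sigma> \<in> perms n \<Longrightarrow> length \<sigma> = n"
  by (simp add: perms_def)

text \<open>Each entry of a permutation equals its rank among all entries, so the comparisons
  between entries determine the list.\<close>

lemma perms_eqI:
  assumes "\<sigma> \<in> perms n" "\<tau> \<in> perms n"
    and "\<And>i j. i < n \<Longrightarrow> j < n \<Longrightarrow> \<sigma> ! i < \<sigma> ! j \<longleftrightarrow> \<tau> ! i < \<tau> ! j"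
  shows "\<sigma> = \<tau>"
proof (rule nth_equalityI)
  show "length \<sigma> = length \<tau>" using assms by (simp add: perms_length)
  fix i assume "i < length \<sigma>"
  then have i: "i < n" using assms by (simp add: perms_length)
  have "{j\<in>{..<n}. \<sigma> ! j \<le> \<sigma> ! i} = {j\<in>{..<n}. \<tau> ! j \<le> \<tau> ! i}"
    using assms(3)[OF i] by (auto simp flip: not_less)
  then show "\<sigma> ! i = \<tau> ! i"
    using perms_rank[OF assms(1) perms_nth_mem[OF assms(1) i]]
      perms_rank[OF assms(2) perms_nth_mem[OF assms(2) i]] by simp
qed

lemma pat_eqI:
  assumes "finite S" "increasing_enum X S e" "inj_on Y S" "\<sigma> \<in> perms (card S)"
    and "\<And>i j. i < card S \<Longrightarrow> j < card S \<Longrightarrow> \<sigma> ! i < \<sigma> ! j \<longleftrightarrow> Y (e i) < Y (e j)"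
  shows "pat X Y S = \<sigma>"
  using assms by (intro perms_eqI[OF pat_perms]) (auto simp: pat_less_iff intro: enum_inj_on)

text \<open>Only order comparisons enter a pattern, so it is carried along any injection that
  respects them. This transfer rule later yields restriction to subsets, relabelling of the sample
  points, and the dependence of \<open>PiSeq\<close> on comparisons alone; in the last case the
  injection is \<open>id\<close>.\<close>

lemma pat_image:
  assumes "finite I" "inj_on f I" "inj_on X' I" 
    and X: "\<And>a b. a \<in> I \<Longrightarrow> b \<in> I \<Longrightarrow> X (f a) < X (f b) \<longleftrightarrow> X' a < X' b"
    and Y: "\<And>a b. a \<in> I \<Longrightarrow> b \<in> I \<Longrightarrow> Y (f a) < Y (f b) \<longleftrightarrow> Y' a < Y' b"
  shows "pat X Y (f ` I) = pat X' Y' I"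
proof -
  have cI: "card (f ` I) = card I" using assms by (simp add: card_image)
  obtain e where e: "increasing_enum X' I e" using assms enum_exists by blast
  then have bij: "bij_betw e {..<card I} I" by (simp add: increasing_enum_def)
  then have mem: "i < card I \<Longrightarrow> e i \<in> I" for i by (auto simp: bij_betw_def)
  have "bij_betw f I (f ` I)" using assms(2) by (simp add: inj_on_imp_bij_betw)
  from bij_betw_trans[OF bij this]
  have e': "increasing_enum X (f ` I) (f \<circ> e)"
    using e mem by (simp add: increasing_enum_def cI X)
  have "card {b \<in> f ` I. Y b \<le> Y (f a)} = card {b \<in> I. Y' b \<le> Y' a}" if "a \<in> I" for a
  proof -
    have "{b \<in> f ` I. Y b \<le> Y (f a)} = f ` {b \<in> I. Y' b \<le> Y' a}"
      using Y that by (auto simp flip: not_less)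
    then show ?thesis using assms(2) by (simp add: card_image inj_on_subset)
  qed
  then show ?thesis using mem by (simp add: pat_enum[OF e] pat_enum[OF e'] cI)
qed

text \<open>Positions are counted from 0.\<close>
definition sub_pat :: "nat list \<Rightarrow> nat set \<Rightarrow> nat list" where
  "sub_pat \<pi> I = pat id ((!) \<pi>) I"

lemma perms_inj_on: "\<pi> \<in> perms n \<Longrightarrow> I \<subseteq> {..<n} \<Longrightarrow> inj_on ((!) \<pi>) I"
  by (meson bij_betw_def inj_on_subset perms_bij_betw)

lemma sub_pat_perms:
  assumes "\<pi> \<in> perms n" "I \<subseteq> {..<n}"
  shows "sub_pat \<pi> I \<in> perms (card I)"
  unfolding sub_pat_def using assms
  by (intro pat_perms perms_inj_on) (auto intro: finite_subset)

text \<open>The enumeration identifies points with positions and preserves both orders. Hence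
  subsets of the point set can be studied as sets of positions in its associated
  permutation.\<close>

lemma pat_image_enum:
  assumes "finite S" "increasing_enum X S e" "I \<subseteq> {..<card S}"
  shows "pat X Y (e ` I) = sub_pat (pat X Y S) I"
  unfolding sub_pat_def
proof (rule pat_image)
  have *: "i < card S" if "i \<in> I" for i using assms that by auto
  show "finite I" using assms by (auto intro: finite_subset)
  show "inj_on e I" using assms by (auto simp: increasing_enum_def bij_betw_def intro: inj_on_subset)
  fix a b assume "a \<in> I" "b \<in> I"
  then show "X (e a) < X (e b) \<longleftrightarrow> id a < id b" 
    using assms * by (auto simp: increasing_enum_def)
  show "Y (e a) < Y (e b) \<longleftrightarrow> pat X Y S ! a < pat X Y S ! b"
    using \<open>a \<in> I\<close> \<open>b \<in> I\<close> * pat_less_iff[OF assms(1,2), of a b Y] by blast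
qed auto

lemma sub_pat_full: "\<pi> \<in> perms n \<Longrightarrow> sub_pat \<pi> {..<n} = \<pi>"
  unfolding sub_pat_def
  by (rule pat_eqI[where e = id]) (auto simp: increasing_enum_def intro: perms_inj_on)

text \<open>The sorted list of I is the increasing enumeration of I. Replacing the comparisons by an
  equation shows that every set of positions carries exactly one pattern, which is what the counting
  arguments rely on.\<close>

lemma occurs_at_iff:
  assumes "\<sigma> \<in> perms m" "\<pi> \<in> perms n" "I \<subseteq> {..<n}" "card I = m"
  shows "occurs_at \<sigma> \<pi> I \<longleftrightarrow> sub_pat \<pi> I = \<sigma>"
proof -
  define e where "e = (!) (sorted_list_of_set I)"
  have fin: "finite I" using assms by (auto intro: finite_subset)
  have len: "length (sorted_list_of_set I) = m" using assms(4) by simp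
  have srt: "sorted_wrt (<) (sorted_list_of_set I)" by simp
  have "bij_betw e {..<card I} I"
    unfolding e_def using fin by (intro bij_betw_nth) auto
  moreover have "e i < e j \<longleftrightarrow> i < j" if "i < card I" "j < card I" for i j
    unfolding e_def using srt that len assms(4)
    by (metis linorder_neqE_nat not_less_iff_gr_or_eq sorted_wrt_iff_nth_less)
  ultimately have en: "increasing_enum id I e" by (simp add: increasing_enum_def)
  have "occurs_at \<sigma> \<pi> I \<longleftrightarrow> (\<forall>i<m. \<forall>j<m. \<sigma> ! i < \<sigma> ! j \<longleftrightarrow> \<pi> ! e i < \<pi> ! e j)"
    by (simp add: occurs_at_def Let_def perms_length[OF assms(1)] e_def)
  also have "\<dots> \<longleftrightarrow> sub_pat \<pi> I = \<sigma>"
  proof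
    assume "\<forall>i<m. \<forall>j<m. \<sigma> ! i < \<sigma> ! j \<longleftrightarrow> \<pi> ! e i < \<pi> ! e j"
    then show "sub_pat \<pi> I = \<sigma>"
      unfolding sub_pat_def using en fin assms by (intro pat_eqI) (auto intro: perms_inj_on)
  next
    assume "sub_pat \<pi> I = \<sigma>"
    then show "\<forall>i<m. \<forall>j<m. \<sigma> ! i < \<sigma> ! j \<longleftrightarrow> \<pi> ! e i < \<pi> ! e j"
      using pat_less_iff[OF fin en, of _ _ "(!) \<pi>"] assms(4) by (auto simp: sub_pat_def)
  qed
  finally show ?thesis .
qed

section \<open>Pattern frequencies as counts of subsets\<close>

lemma t_perm_sub_pat:
  assumes "\<sigma> \<in> perms m" "\<pi> \<in> perms n" "m \<le> n"
  shows "t_perm \<sigma> \<pi> * real (n choose m) = real (card {I. I \<subseteq> {..<n} \<and> card I = m \<and> sub_pat \<pi> I = \<sigma>})"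
proof -
  have "{I. I \<subseteq> {..<n} \<and> card I = m \<and> occurs_at \<sigma> \<pi> I} = {I. I \<subseteq> {..<n} \<and> card I = m \<and> sub_pat \<pi> I = \<sigma>}"
    using occurs_at_iff[OF assms(1,2)] by blast
  then show ?thesis using assms by (simp add: t_perm_def perms_length)
qed

text \<open>Taking images under the increasing enumeration is a bijection from m-sets of positions
  to m-subsets of S, and it preserves patterns by \<open>pat_image_enum\<close>.\<close>

lemma t_perm_card_pat:
  assumes "finite S" "inj_on X S" "inj_on Y S" "\<sigma> \<in> perms m" "m \<le> card S"
  shows "t_perm \<sigma> (pat X Y S) * real (card S choose m)
    = real (card {J. J \<subseteq> S \<and> card J = m \<and> pat X Y J = \<sigma>})"
proof -
  obtain e where e: "increasing_enum X S e" using assms enum_exists by blast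
  then have bij: "bij_betw e {..<card S} S" by (simp add: increasing_enum_def)
  have img: "e ` {..<card S} = S" and inj: "inj_on e {..<card S}" using bij by (auto simp: bij_betw_def)
  let ?A = "{I. I \<subseteq> {..<card S} \<and> card I = m \<and> sub_pat (pat X Y S) I = \<sigma>}"
  let ?B = "{J. J \<subseteq> S \<and> card J = m \<and> pat X Y J = \<sigma>}"
  have "inj_on ((`) e) ?A"
    by (rule inj_on_subset[OF inj_on_image_Pow[OF inj]]) auto
  moreover have "(`) e ` ?A = ?B"
  proof (intro subset_antisym subsetI)
    fix J assume "J \<in> (`) e ` ?A"
    then obtain I where "I \<in> ?A" "J = e ` I" by blast
    then show "J \<in> ?B"
      using img inj pat_image_enum[OF assms(1) e, of I Y]
      by (auto simp: card_image inj_on_subset)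
  next
    fix J assume J: "J \<in> ?B"
    then obtain I where I: "I \<subseteq> {..<card S}" "J = e ` I" using img by (metis (mono_tags) mem_Collect_eq subset_imageE)
    moreover have "card I = card J" using I inj by (metis card_image inj_on_subset)
    ultimately show "J \<in> (`) e ` ?A"
      using J pat_image_enum[OF assms(1) e, of I Y] by auto
  qed
  ultimately have "card ?A = card ?B" using card_image by fastforce
  then show ?thesis using t_perm_sub_pat[OF assms(4) pat_perms[OF assms(1-3)] assms(5)] by simp
qed

section \<open>The double-insertion chain\<close>

lemma t_perm_sub_pat_card:
  assumes "\<pi> \<in> perms n" "I \<subseteq> {..<n}" "\<sigma> \<in> perms m" "m \<le> card I"
  shows "t_perm \<sigma> (sub_pat \<pi> I) * real (card I choose m)
    = real (card {J. J \<subseteq> I \<and> card J = m \<and> sub_pat \<pi> J = \<sigma>})"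
  unfolding sub_pat_def using assms
  by (intro t_perm_card_pat perms_inj_on) (auto intro: finite_subset)

lemma finite_perms: "finite (perms n)"
proof (rule finite_subset)
  show "perms n \<subseteq> {xs. set xs \<subseteq> {1..n} \<and> length xs = n}" by (auto simp: perms_def)
qed (simp add: finite_lists_length_eq)

lemma subsets_card_pred: "{I. I \<subseteq> {..<Suc n} \<and> card I = n} = (\<lambda>i. {..<Suc n} - {i}) ` {..<Suc n}"
proof (intro subset_antisym subsetI)
  fix I assume "I \<in> {I. I \<subseteq> {..<Suc n} \<and> card I = n}"
  then have I: "I \<subseteq> {..<Suc n}" "card I = n" by auto
  then have "card ({..<Suc n} - I) = 1" by (subst card_Diff_subset) (auto intro: finite_subset)
  then obtain i where "{..<Suc n} - I = {i}" by (auto simp: card_1_singleton_iff)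
  with I show "I \<in> (\<lambda>i. {..<Suc n} - {i}) ` {..<Suc n}" by blast
qed auto

lemma inj_on_remove: "inj_on (\<lambda>i. S - {i}) S"
  by (auto simp: inj_on_def)

lemma card_subsets_card_pred:
  "card {I. I \<subseteq> {..<Suc n} \<and> card I = n \<and> P I} = card {i\<in>{..<Suc n}. P ({..<Suc n} - {i})}"
proof -
  have "{I. I \<subseteq> {..<Suc n} \<and> card I = n \<and> P I} = {I \<in> {I. I \<subseteq> {..<Suc n} \<and> card I = n}. P I}"
    by simp
  also have "\<dots> = (\<lambda>i. {..<Suc n} - {i}) ` {i\<in>{..<Suc n}. P ({..<Suc n} - {i})}"
    unfolding subsets_card_pred by blast
  finally have "{I. I \<subseteq> {..<Suc n} \<and> card I = n \<and> P I}
    = (\<lambda>i. {..<Suc n} - {i}) ` {i\<in>{..<Suc n}. P ({..<Suc n} - {i})}" .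
  moreover have "inj_on (\<lambda>i. {..<Suc n} - {i}) {i\<in>{..<Suc n}. P ({..<Suc n} - {i})}"
    by (rule inj_on_subset[OF inj_on_remove]) auto
  ultimately show ?thesis by (simp add: card_image)
qed

lemma t_perm_Suc:
  assumes "\<sigma> \<in> perms n" "\<tau> \<in> perms (Suc n)"
  shows "real (Suc n) * t_perm \<sigma> \<tau> = real (card {i\<in>{..<Suc n}. sub_pat \<tau> ({..<Suc n} - {i}) = \<sigma>})"
proof -
  have "Suc n choose n = Suc n" using binomial_symmetric[of n "Suc n"] by simp
  then show ?thesis
    using t_perm_sub_pat[OF assms] card_subsets_card_pred[of n "\<lambda>I. sub_pat \<tau> I = \<sigma>"]
    by (simp add: mult.commute)
qed

text \<open>Double counting of pairs (i, J), where J is an occurrence of x in y and i is a position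
  outside J. Summing over i first gives the frequencies of x after one deletion; summing over J
  first gives \<open>Suc n - m\<close> choices of i for each occurrence.\<close>

lemma t_perm_tower:
  assumes x: "x \<in> perms m" and y: "y \<in> perms (Suc n)" and mn: "m \<le> n"
  shows "(\<Sum>z\<in>perms n. t_perm x z * t_perm z y) = t_perm x y"
proof -
  let ?I = "\<lambda>i. {..<Suc n} - {i}"
  let ?J = "{J. J \<subseteq> {..<Suc n} \<and> card J = m \<and> sub_pat y J = x}"
  have fJ: "finite ?J" by (rule finite_subset[of _ "Pow {..<Suc n}"]) auto
  have cI: "card (?I i) = n" if "i < Suc n" for i using that by simp
  have mem: "sub_pat y (?I i) \<in> perms n" if "i < Suc n" for i
    using sub_pat_perms[OF y, of "?I i"] cI[OF that] by auto
  have "real (Suc n) * (\<Sum>z\<in>perms n. t_perm x z * t_perm z y)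
      = (\<Sum>z\<in>perms n. t_perm x z * (real (Suc n) * t_perm z y))"
    by (simp add: sum_distrib_left mult_ac)
  \<comment> \<open>Positions i are grouped by the permutation z that is left when i is deleted;
    \<open>sum.group\<close> then removes the outer sum.\<close>
  also have "\<dots> = (\<Sum>z\<in>perms n. \<Sum>i | i \<in> {..<Suc n} \<and> sub_pat y (?I i) = z. t_perm x (sub_pat y (?I i)))"
  proof (rule sum.cong)
    fix z assume "z \<in> perms n"
    have "(\<Sum>i | i \<in> {..<Suc n} \<and> sub_pat y (?I i) = z. t_perm x (sub_pat y (?I i)))
      = (\<Sum>i | i \<in> {..<Suc n} \<and> sub_pat y (?I i) = z. t_perm x z)"
      by (rule sum.cong) auto
    then show "t_perm x z * (real (Suc n) * t_perm z y)
      = (\<Sum>i | i \<in> {..<Suc n} \<and> sub_pat y (?I i) = z. t_perm x (sub_pat y (?I i)))"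
      by (simp only: t_perm_Suc[OF \<open>z \<in> perms n\<close> y]) simp
  qed simp
  also have "\<dots> = (\<Sum>i<Suc n. t_perm x (sub_pat y (?I i)))"
    by (rule sum.group) (auto simp: finite_perms mem)
  finally have 1: "real (Suc n) * (\<Sum>z\<in>perms n. t_perm x z * t_perm z y)
    = (\<Sum>i<Suc n. t_perm x (sub_pat y (?I i)))" .
  have "real (n choose m) * (\<Sum>i<Suc n. t_perm x (sub_pat y (?I i)))
    = (\<Sum>i<Suc n. real (card {J. J \<subseteq> ?I i \<and> card J = m \<and> sub_pat y J = x}))"
    unfolding sum_distrib_left
  proof (rule sum.cong)
    fix i assume "i \<in> {..<Suc n}"
    then show "real (n choose m) * t_perm x (sub_pat y (?I i))
      = real (card {J. J \<subseteq> ?I i \<and> card J = m \<and> sub_pat y J = x})"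
      using t_perm_sub_pat_card[OF y _ x, of "?I i"] cI[of i] mn by (simp add: mult.commute)
  qed simp
  \<comment> \<open>The occurrences that survive the deletion of i are those avoiding i, so this
    counts the pairs (i, J) and the two sums can be exchanged.\<close>
  also have "\<dots> = (\<Sum>i<Suc n. \<Sum>J\<in>?J. if i \<in> J then 0 else 1)"
  proof (rule sum.cong)
    fix i assume "i \<in> {..<Suc n}"
    have "{J. J \<subseteq> ?I i \<and> card J = m \<and> sub_pat y J = x} = {J\<in>?J. i \<notin> J}" by auto
    then show "real (card {J. J \<subseteq> ?I i \<and> card J = m \<and> sub_pat y J = x})
       = (\<Sum>J\<in>?J. if i \<in> J then 0 else 1)"
      using fJ by (simp add: sum.If_cases Int_def)
  qed simp
  also have "\<dots> = (\<Sum>J\<in>?J. \<Sum>i<Suc n. if i \<in> J then 0 else 1)"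
    by (rule sum.swap)
  also have "\<dots> = (\<Sum>J\<in>?J. real (Suc n - m))"
  proof (rule sum.cong)
    fix J assume J: "J \<in> ?J"
    then have "{..<Suc n} \<inter> - {i. i \<in> J} = {..<Suc n} - J" by auto
    moreover have "finite J" using J by (auto intro: finite_subset)
    ultimately have "(\<Sum>i<Suc n. if i \<in> J then 0 else (1::real)) = real (card ({..<Suc n} - J))"
      by (subst sum.If_cases) simp_all
    also have "card ({..<Suc n} - J) = Suc n - m"
      using J \<open>finite J\<close> by (subst card_Diff_subset) auto
    finally show "(\<Sum>i<Suc n. if i \<in> J then 0 else (1::real)) = real (Suc n - m)" .
  qed simp
  also have "\<dots> = real (Suc n - m) * real (card ?J)" by simp
  also have "\<dots> = real (Suc n - m) * real (Suc n choose m) * t_perm x y"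
    using t_perm_sub_pat[OF x y] mn by (simp add: mult_ac)
  \<comment> \<open>Absorption for binomial coefficients makes \<open>n choose m\<close> a common
    factor of both sides, to be cancelled below.\<close>
  also have "real (Suc n - m) * real (Suc n choose m) = real (Suc n) * real (n choose m)"
    using arg_cong[OF binomial_absorb_comp[of "Suc n" m], of real] by (simp only: of_nat_mult diff_Suc_1)
  finally have 2: "real (n choose m) * (\<Sum>i<Suc n. t_perm x (sub_pat y (?I i)))
    = real (n choose m) * (real (Suc n) * t_perm x y)" by (simp add: mult_ac)
  moreover have "real (n choose m) \<noteq> 0" using mn by simp
  ultimately have "(\<Sum>i<Suc n. t_perm x (sub_pat y (?I i))) = real (Suc n) * t_perm x y"
    by (metis mult_cancel_left)
  with 1 show ?thesis by (simp del: of_nat_Suc)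
qed

section \<open>Inserting a value as the inverse of deleting a position\<close>

definition skip :: "nat \<Rightarrow> nat \<Rightarrow> nat" where
  "skip i k = (if k < i then k else Suc k)"

lemma skip_image:
  assumes "i \<le> n"
  shows "skip i ` {..<n} = {..<Suc n} - {i}"
proof (intro subset_antisym subsetI)
  fix k assume k: "k \<in> {..<Suc n} - {i}"
  show "k \<in> skip i ` {..<n}"
  proof (cases "k < i")
    case True
    then have "k = skip i k" "k < n" using assms by (auto simp: skip_def)
    then show ?thesis by blast
  next
    case False
    then have "k = skip i (k - 1)" "k - 1 < n" using k by (auto simp: skip_def)
    then show ?thesis by blast
  qed
qed (auto simp: skip_def)

text \<open>\<open>ins\<close> counts positions from 1 and lists count from 0, hence
  \<open>Suc i\<close>. The old position k moves to \<open>skip i k\<close>, so these equations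
  describe every entry of the result.\<close>

lemma ins_nth:
  assumes "length \<sigma> = n" "i \<le> n"
  shows "length (ins \<sigma> (Suc i) j) = Suc n" "ins \<sigma> (Suc i) j ! i = j"
    "k < n \<Longrightarrow> ins \<sigma> (Suc i) j ! skip i k = (if j \<le> \<sigma> ! k then \<sigma> ! k + 1 else \<sigma> ! k)"
  using assms by (auto simp: ins_def Let_def nth_append skip_def min_def nth_Cons' Suc_diff_le)

text \<open>The entry at position i forces the value of j. At all other positions, raising the
  values from j upwards undoes the loss of one rank that deleting the entry j causes for the larger
  values.\<close>

lemma ins_eq_iff:
  assumes s: "\<sigma> \<in> perms n" and t: "\<tau> \<in> perms (Suc n)" and i: "i \<le> n"
  shows "ins \<sigma> (Suc i) j = \<tau> \<longleftrightarrow> j = \<tau> ! i \<and> sub_pat \<tau> ({..<Suc n} - {i}) = \<sigma>"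
proof -
  let ?I = "{..<Suc n} - {i}"
  have len: "length \<sigma> = n" "length \<tau> = Suc n" using s t by (auto simp: perms_def)
  have img: "skip i ` {..<n} = ?I" by (rule skip_image[OF i])
  have cI: "card ?I = n" using i by simp
  have "inj (skip i)" by (auto simp: inj_on_def skip_def split: if_splits)
  then have "bij_betw (skip i) {..<n} ?I" using img by (auto simp: bij_betw_def intro: inj_on_subset)
  then have en: "increasing_enum id ?I (skip i)" by (auto simp: increasing_enum_def cI skip_def)
  have ti: "\<tau> ! i \<in> {1..Suc n}" using perms_nth_mem[OF t] i by simp
  have inj: "inj_on ((!) \<tau>) {..<Suc n}" using perms_inj_on[OF t] by blast
  \<comment> \<open>An entry of \<tau> is its own rank; removing position i lowers this rank by one
    exactly when the removed entry was counted in it.\<close>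
  have sub: "sub_pat \<tau> ?I ! k = (if \<tau> ! i \<le> \<tau> ! skip i k then \<tau> ! skip i k - 1 else \<tau> ! skip i k)"
    if "k < n" for k
  proof -
    have sk: "skip i k < Suc n" using that by (simp add: skip_def)
    let ?v = "\<tau> ! skip i k"
    have v: "?v \<in> {1..Suc n}" using perms_nth_mem[OF t sk] .
    have "{b\<in>?I. \<tau> ! b \<le> ?v} = {b\<in>{..<Suc n}. \<tau> ! b \<le> ?v} - {i}" by auto
    then have "card {b\<in>?I. \<tau> ! b \<le> ?v} = (if \<tau> ! i \<le> ?v then ?v - 1 else ?v)"
      using perms_rank[OF t v] i by (simp add: card_Diff_singleton_if)
    then show ?thesis using that by (simp add: sub_pat_def pat_enum[OF en] cI)
  qed
  \<comment> \<open>The two shifts are inverse to each other only away from the inserted value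
    itself; this excludes that value.\<close>
  have neq: "\<tau> ! skip i k \<noteq> \<tau> ! i" if "k < n" for k
  proof -
    have "skip i k \<noteq> i" "skip i k < Suc n" using that by (auto simp: skip_def)
    then show ?thesis using inj i by (auto dest: inj_onD)
  qed
  have "(ins \<sigma> (Suc i) j = \<tau>) \<longleftrightarrow> j = \<tau> ! i \<and> (\<forall>k<n. ins \<sigma> (Suc i) j ! skip i k = \<tau> ! skip i k)"
  proof
    assume "j = \<tau> ! i \<and> (\<forall>k<n. ins \<sigma> (Suc i) j ! skip i k = \<tau> ! skip i k)"
    then have *: "j = \<tau> ! i" "\<And>k. k < n \<Longrightarrow> ins \<sigma> (Suc i) j ! skip i k = \<tau> ! skip i k" by auto
    show "ins \<sigma> (Suc i) j = \<tau>"
    proof (rule nth_equalityI)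
      fix l assume "l < length (ins \<sigma> (Suc i) j)"
      then have "l < Suc n" using ins_nth(1)[OF len(1) i] by simp
      then have "l = i \<or> l \<in> skip i ` {..<n}" using img by auto
      then show "ins \<sigma> (Suc i) j ! l = \<tau> ! l" using * ins_nth(2)[OF len(1) i] by auto
    qed (simp add: ins_nth(1)[OF len(1) i] len)
  qed (use ins_nth(2)[OF len(1) i] in auto)
  also have "\<dots> \<longleftrightarrow> j = \<tau> ! i \<and> (\<forall>k<n. sub_pat \<tau> ?I ! k = \<sigma> ! k)"
  proof (intro conj_cong refl all_cong)
    fix k assume "j = \<tau> ! i" "k < n"
    then show "(ins \<sigma> (Suc i) j ! skip i k = \<tau> ! skip i k) = (sub_pat \<tau> ?I ! k = \<sigma> ! k)"
      using neq[of k] ti by (auto simp: ins_nth(3)[OF len(1) i] sub)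
  qed
  also have "(\<forall>k<n. sub_pat \<tau> ?I ! k = \<sigma> ! k) \<longleftrightarrow> sub_pat \<tau> ?I = \<sigma>"
    using len cI by (auto simp: list_eq_iff_nth_eq sub_pat_def)
  finally show ?thesis .
qed

text \<open>Each position of \<tau> whose deletion leaves \<sigma> comes from exactly one pair (I,
  J), since J has to be the entry there. Among (n+1)^2 pairs there are thus (n+1) t(\<sigma>,
  \<tau>) favourable ones.\<close>

lemma pH_eq:
  assumes s: "\<sigma> \<in> perms n" and t: "\<tau> \<in> perms (Suc n)"
  shows "pH \<sigma> \<tau> = t_perm \<sigma> \<tau> / real (Suc n)"
proof -
  let ?D = "{i\<in>{..<Suc n}. sub_pat \<tau> ({..<Suc n} - {i}) = \<sigma>}"
  have "{(i, j). i \<in> {1..n+1} \<and> j \<in> {1..n+1} \<and> ins \<sigma> i j = \<tau>} = (\<lambda>i. (Suc i, \<tau> ! i)) ` ?D"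
  proof (intro subset_antisym subsetI)
    fix p assume "p \<in> {(i, j). i \<in> {1..n+1} \<and> j \<in> {1..n+1} \<and> ins \<sigma> i j = \<tau>}"
    then obtain i j where p: "p = (Suc i, j)" "i \<le> n" "ins \<sigma> (Suc i) j = \<tau>"
      by (auto simp: Suc_le_eq gr0_conv_Suc)
    then show "p \<in> (\<lambda>i. (Suc i, \<tau> ! i)) ` ?D" using ins_eq_iff[OF s t p(2)] by auto
  next
    fix p assume "p \<in> (\<lambda>i. (Suc i, \<tau> ! i)) ` ?D"
    then obtain i where i: "i \<in> ?D" "p = (Suc i, \<tau> ! i)" by blast
    then show "p \<in> {(i, j). i \<in> {1..n+1} \<and> j \<in> {1..n+1} \<and> ins \<sigma> i j = \<tau>}"
      using ins_eq_iff[OF s t, of i] perms_nth_mem[OF t, of i] by auto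
  qed
  moreover have "inj_on (\<lambda>i. (Suc i, \<tau> ! i)) ?D" by (auto simp: inj_on_def)
  ultimately have "card {(i, j). i \<in> {1..n+1} \<and> j \<in> {1..n+1} \<and> ins \<sigma> i j = \<tau>} = card ?D"
    by (simp add: card_image)
  then have "pH \<sigma> \<tau> = real (card ?D) / real ((n + 1)^2)"
    by (simp add: pH_def perms_length[OF s])
  also have "\<dots> = t_perm \<sigma> \<tau> / real (Suc n)"
    unfolding t_perm_Suc[OF s t, symmetric] power2_eq_square of_nat_mult by simp
  finally show ?thesis .
qed

section \<open>Several steps of the double-insertion chain and its Martin kernel\<close>

lemma t_perm_same_length:
  assumes "x \<in> perms n" "y \<in> perms n"
  shows "t_perm x y = (if x = y then 1 else 0)"
proof -
  have "{I. I \<subseteq> {..<n} \<and> card I = n \<and> sub_pat y I = x} = (if x = y then {{..<n}} else {})"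
  proof -
    have "{I. I \<subseteq> {..<n} \<and> card I = n \<and> sub_pat y I = x} \<subseteq> {{..<n}}"
      using card_subset_eq[of "{..<n}"] by auto
    then show ?thesis using sub_pat_full[OF assms(2)] by auto
  qed
  then show ?thesis using t_perm_sub_pat[OF assms] by simp
qed

text \<open>By induction on k: the step from length m + k contributes the factor 1/(m+k+1) through
  \<open>pH_eq\<close>, and \<open>t_perm_tower\<close> sums out the intermediate
  permutation.\<close>

lemma transH_eq:
  assumes "x \<in> perms m" "y \<in> perms (m + k)"
  shows "transH k x y = fact m / fact (m + k) * t_perm x y"
  using assms(2)
proof (induction k arbitrary: y)
  case 0
  then show ?case using assms(1) by (simp add: t_perm_same_length)
next
  case (Suc k)
  then have y: "y \<in> perms (Suc (m + k))" by simp
  have "transH (Suc k) x y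
    = (\<Sum>z\<in>perms (m + k). fact m / fact (m + k) * t_perm x z * (t_perm z y / real (Suc (m + k))))"
    using Suc.IH by (auto simp: perms_length[OF assms(1)] pH_eq[OF _ y] intro!: sum.cong)
  also have "\<dots> = fact m / (fact (m + k) * real (Suc (m + k))) * (\<Sum>z\<in>perms (m + k). t_perm x z * t_perm z y)"
    unfolding sum_distrib_left by (rule sum.cong) simp_all
  also have "fact (m + k) * real (Suc (m + k)) = fact (m + Suc k)" by (simp add: mult_ac)
  finally show ?case by (simp only: t_perm_tower[OF assms(1) y le_add1])
qed

lemma perms_1: "perms 1 = {[1]}"
proof (intro subset_antisym subsetI)
  fix xs assume "xs \<in> perms 1"
  then have "length xs = 1" "set xs = {1}" by (simp_all add: perms_def)
  then show "xs \<in> {[1]}" by (metis insertI1 length_0_conv list.collapse list.set_intros(1) list.size(4) One_nat_def add_right_cancel add_0 singletonD zero_neq_one)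
qed (simp add: perms_def)

lemma t_perm_singleton:
  assumes "y \<in> perms n" "n \<ge> 1"
  shows "t_perm [1] y = 1"
proof -
  have "sub_pat y I = [1]" if "I \<subseteq> {..<n}" "card I = 1" for I
    using sub_pat_perms[OF assms(1) that(1)] unfolding that(2) perms_1 by blast
  then have "{I. I \<subseteq> {..<n} \<and> card I = 1 \<and> sub_pat y I = [1]} = {I. I \<subseteq> {..<n} \<and> card I = 1}"
    by auto
  moreover have "[1] \<in> perms 1" using perms_1 by blast
  ultimately show ?thesis
    using t_perm_sub_pat[of "[1]" 1 y n] assms n_subsets[of "{..<n}" 1] by simp
qed

text \<open>The initial permutation has frequency 1 in every y, so the chain is uniformly
  distributed on the permutations of each length n. Multiplying by n! leaves m! t(x, y); if x is
  longer than y, both sides are 0.\<close>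

lemma KH_eq:
  assumes "x \<in> perms m" "y \<in> allperms" "m \<ge> 1"
  shows "KH x y = fact m * t_perm x y"
proof -
  obtain n where y: "y \<in> perms n" "n \<ge> 1" using assms by (auto simp: allperms_def)
  have len: "length x = m" "length y = n" using assms y by (auto simp: perms_def)
  have "probH y = 1 / fact n"
    using transH_eq[of "[1]" 1 y "n - 1"] y perms_1 t_perm_singleton[OF y] by (simp add: probH_def len)
  then show ?thesis
    using transH_eq[OF assms(1), of y "n - m"] y by (auto simp: KH_def len t_perm_def)
qed

section \<open>Permutations of random samples\<close>

text \<open>Extends \<open>PiSeq\<close> from initial segments to arbitrary index sets, with the
  same default \<open>[]\<close> on ties, so that exchangeability can move the first m points to any
  J.\<close>

definition pat_at :: "nat set \<Rightarrow> (nat \<Rightarrow> real \<times> real) \<Rightarrow> nat list" where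
  "pat_at J \<omega> = (if inj_on (fst \<circ> \<omega>) J \<and> inj_on (snd \<circ> \<omega>) J then pat (fst \<circ> \<omega>) (snd \<circ> \<omega>) J else [])"

lemma assoc_perm_pat: "assoc_perm n p = pat (fst \<circ> p) (snd \<circ> p) {..<n}"
  by (simp add: assoc_perm_def pat_def rank_x_def rank_y_def)

lemma PiSeq_pat_at: "PiSeq n \<omega> = pat_at {..<n} \<omega>"
  by (simp add: PiSeq_def pat_at_def no_ties_def assoc_perm_pat)

lemma PiSeq_perms: "no_ties n \<omega> \<Longrightarrow> PiSeq n \<omega> \<in> perms n"
  using pat_perms[of "{..<n}" "fst \<circ> \<omega>" "snd \<circ> \<omega>"]
  by (simp add: PiSeq_def no_ties_def assoc_perm_pat)

lemma perms_not_Nil: "y \<in> perms n \<Longrightarrow> n \<ge> 1 \<Longrightarrow> y \<noteq> []"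
  by (auto simp: perms_def)

text \<open>The default \<open>[]\<close> is not a permutation of positive length, so it cannot be
  mistaken for the value y.\<close>

lemma PiSeq_eq_iff:
  assumes "y \<in> perms n" "n \<ge> 1"
  shows "PiSeq n \<omega> = y \<longleftrightarrow> no_ties n \<omega> \<and> assoc_perm n \<omega> = y"
  using perms_not_Nil[OF assms] by (auto simp: PiSeq_def)

text \<open>A pattern sorts its points by first coordinate, so it sees only which points are
  selected and not the order of their labels.\<close>

lemma PiSeq_comp:
  assumes "inj_on g {..<m}"
  shows "PiSeq m (\<omega> \<circ> g) = pat_at (g ` {..<m}) \<omega>"
proof -
  have inj: "inj_on (h \<circ> (\<omega> \<circ> g)) {..<m} \<longleftrightarrow> inj_on (h \<circ> \<omega>) (g ` {..<m})" for h :: "real \<times> real \<Rightarrow> real"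
    using comp_inj_on_iff[OF assms, of "h \<circ> \<omega>"] by (simp add: comp_assoc)
  show ?thesis
  proof (cases "inj_on (fst \<circ> \<omega>) (g ` {..<m}) \<and> inj_on (snd \<circ> \<omega>) (g ` {..<m})")
    case True
    then have "pat (fst \<circ> \<omega>) (snd \<circ> \<omega>) (g ` {..<m}) = pat (fst \<circ> (\<omega> \<circ> g)) (snd \<circ> (\<omega> \<circ> g)) {..<m}"
      using assms inj by (intro pat_image) auto
    with True show ?thesis by (simp only: PiSeq_pat_at pat_at_def inj if_True)
  next
    case False
    then show ?thesis unfolding PiSeq_pat_at pat_at_def inj by argo
  qed
qed

lemma PiSeq_permutes:
  assumes "g permutes {..<n}"
  shows "PiSeq n (\<omega> \<circ> g) = PiSeq n \<omega>"
  using PiSeq_comp[OF permutes_inj_on[OF assms]] permutes_image[OF assms]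
  by (simp add: PiSeq_pat_at)

text \<open>The pointwise core of the averaging argument: once the pattern of all n points is known
  to be y, the number of m-subsets showing x no longer depends on \<omega>.\<close>

lemma card_pat_at:
  assumes x: "x \<in> perms m" "1 \<le> m" and y: "y \<in> perms n" and mn: "m \<le> n" and P: "PiSeq n \<omega> = y"
  shows "real (card {J. J \<subseteq> {..<n} \<and> card J = m \<and> pat_at J \<omega> = x}) = t_perm x y * real (n choose m)"
proof -
  let ?X = "fst \<circ> \<omega>" and ?Y = "snd \<circ> \<omega>"
  have "no_ties n \<omega> \<and> assoc_perm n \<omega> = y" using PiSeq_eq_iff[OF y] P x mn by simp
  then have inj: "inj_on ?X {..<n}" "inj_on ?Y {..<n}" and pat: "pat ?X ?Y {..<n} = y"
    by (auto simp: no_ties_def assoc_perm_pat)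
  have "{J. J \<subseteq> {..<n} \<and> card J = m \<and> pat_at J \<omega> = x}
    = {J. J \<subseteq> {..<n} \<and> card J = m \<and> pat ?X ?Y J = x}"
    using inj_on_subset[OF inj(1)] inj_on_subset[OF inj(2)] by (auto simp: pat_at_def)
  then show ?thesis using t_perm_card_pat[OF _ inj x(1)] mn by (simp add: pat)
qed

text \<open>Glue a bijection onto J and a bijection between the complements, and fix everything from
  n on.\<close>

lemma ex_permutes_image:
  assumes "J \<subseteq> {..<n::nat}" "card J = m"
  obtains g where "g permutes {..<n}" "g ` {..<m} = J"
proof -
  have mn: "m \<le> n" using card_mono[OF _ assms(1)] assms(2) by simp
  have fin: "finite J" using assms by (auto intro: finite_subset)
  obtain f1 where f1: "bij_betw f1 {..<m} J"
    using finite_same_card_bij[of "{..<m}" J] fin assms by auto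
  have "card ({..<n} - {..<m}) = card ({..<n} - J)"
    using assms mn fin by (simp add: card_Diff_subset)
  then obtain f2 where f2: "bij_betw f2 ({..<n} - {..<m}) ({..<n} - J)"
    using finite_same_card_bij[of "{..<n} - {..<m}" "{..<n} - J"] by auto
  define g where "g x = (if x < m then f1 x else if x < n then f2 x else x)" for x
  have g1: "bij_betw g {..<m} J"
    using f1 by (rule bij_betw_cong[THEN iffD1, rotated]) (simp add: g_def)
  have g2: "bij_betw g ({..<n} - {..<m}) ({..<n} - J)"
    using f2 by (rule bij_betw_cong[THEN iffD1, rotated]) (simp add: g_def)
  have "bij_betw g ({..<m} \<union> ({..<n} - {..<m})) (J \<union> ({..<n} - J))"
    using g1 g2 by (rule bij_betw_combine) auto
  moreover have "{..<m} \<union> ({..<n} - {..<m}) = {..<n}" using mn by auto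
  moreover have "J \<union> ({..<n} - J) = {..<n}" using assms by auto
  ultimately have "bij_betw g {..<n} {..<n}" by simp
  then have "g permutes {..<n}" by (rule bij_imp_permutes) (use mn in \<open>auto simp: g_def\<close>)
  then show ?thesis using g1 that by (auto simp: bij_betw_def)
qed

section \<open>The i.i.d. sample and measurability of its patterns\<close>

locale copula_sample =
  fixes \<mu> :: "(real \<times> real) measure"
  assumes copula: "copula_measure \<mu>"
begin

lemma sets_mu [measurable_cong]: "sets \<mu> = sets borel"
  using copula by (simp add: copula_measure_def)

lemma space_mu [simp]: "space \<mu> = UNIV"
  using sets_eq_imp_space_eq[OF sets_mu] by simp

sublocale mu: prob_space \<mu>
  using copula by (simp add: copula_measure_def)

sublocale S: product_prob_space "\<lambda>_::nat. \<mu>" UNIV ..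

abbreviation M :: "(nat \<Rightarrow> real \<times> real) measure" where "M \<equiv> iid \<mu>"

sublocale M: prob_space M
  unfolding iid_def by (rule S.prob_space_axioms)

lemma space_iid [simp]: "space M = UNIV"
  by (simp add: iid_def space_PiM)

lemma borel_measurable_proj:
  "(fst :: real \<times> real \<Rightarrow> real) \<in> borel_measurable borel" "(snd :: real \<times> real \<Rightarrow> real) \<in> borel_measurable borel"
  by (simp_all add: borel_measurable_continuous_onI continuous_on_fst continuous_on_snd)

text \<open>\<open>PiSeq n\<close> depends on \<omega> only through the finitely many comparisons
  recorded in \<open>R\<close>, so the event is a finite union of comparison events. The general
  index set I covers both the finite product behind \<open>t_cop\<close> and the infinite one behind
  \<open>iid\<close>.\<close>

lemma sets_PiSeq:
  assumes "{..<n} \<subseteq> I"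
  shows "{\<omega> \<in> space (PiM I (\<lambda>_. \<mu>)). PiSeq n \<omega> = y} \<in> sets (PiM I (\<lambda>_. \<mu>))"
proof -
  let ?N = "PiM I (\<lambda>_. \<mu>)"
  let ?P = "{..<n} \<times> {..<n}"
  define R where "R \<omega> = ({p\<in>?P. fst (\<omega> (fst p)) \<le> fst (\<omega> (snd p))}, {p\<in>?P. snd (\<omega> (fst p)) \<le> snd (\<omega> (snd p))})"
    for \<omega> :: "nat \<Rightarrow> real \<times> real"
  have dep: "PiSeq n \<omega> = PiSeq n \<omega>'" if "R \<omega> = R \<omega>'" for \<omega> \<omega>'
  proof -
    have le: "fst (\<omega> i) \<le> fst (\<omega> j) \<longleftrightarrow> fst (\<omega>' i) \<le> fst (\<omega>' j)"
      "snd (\<omega> i) \<le> snd (\<omega> j) \<longleftrightarrow> snd (\<omega>' i) \<le> snd (\<omega>' j)" if "i < n" "j < n" for i j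
      using \<open>R \<omega> = R \<omega>'\<close> that by (auto simp: R_def set_eq_iff)
    have inj: "inj_on (fst \<circ> \<omega>) {..<n} \<longleftrightarrow> inj_on (fst \<circ> \<omega>') {..<n}"
      "inj_on (snd \<circ> \<omega>) {..<n} \<longleftrightarrow> inj_on (snd \<circ> \<omega>') {..<n}"
      by (simp_all add: inj_on_def eq_iff[where 'a = real] le)
    show ?thesis
    proof (cases "inj_on (fst \<circ> \<omega>) {..<n} \<and> inj_on (snd \<circ> \<omega>) {..<n}")
      case True
      then have "pat (fst \<circ> \<omega>) (snd \<circ> \<omega>) (id ` {..<n}) = pat (fst \<circ> \<omega>') (snd \<circ> \<omega>') {..<n}"
        using inj by (intro pat_image) (auto simp: le simp flip: not_le)
      then show ?thesis by (simp add: PiSeq_pat_at pat_at_def inj)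
    next
      case False
      then show ?thesis unfolding PiSeq_pat_at pat_at_def inj by argo
    qed
  qed
  have meas: "{\<omega> \<in> space ?N. R \<omega> = (A, B)} \<in> sets ?N" if "A \<subseteq> ?P" "B \<subseteq> ?P" for A B
  proof -
    have "{\<omega> \<in> space ?N. R \<omega> = (A, B)} = {\<omega> \<in> space ?N. \<forall>p\<in>?P.
       (fst (\<omega> (fst p)) \<le> fst (\<omega> (snd p)) \<longleftrightarrow> p \<in> A) \<and> (snd (\<omega> (fst p)) \<le> snd (\<omega> (snd p)) \<longleftrightarrow> p \<in> B)}"
      using that unfolding R_def by blast
    also have "\<dots> \<in> sets ?N"
    proof (rule sets.sets_Collect_finite_All)
      fix p assume "p \<in> ?P"
      then have "(\<lambda>\<omega>. \<omega> (fst p)) \<in> measurable ?N borel" "(\<lambda>\<omega>. \<omega> (snd p)) \<in> measurable ?N borel"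
        using assms by (auto intro!: measurable_component_singleton simp flip: measurable_cong_sets[OF refl sets_mu])
      note borel = measurable_compose[OF this(1)] measurable_compose[OF this(2)]
      have le: "{\<omega> \<in> space ?N. fst (\<omega> (fst p)) \<le> fst (\<omega> (snd p))} \<in> sets ?N"
        "{\<omega> \<in> space ?N. snd (\<omega> (fst p)) \<le> snd (\<omega> (snd p))} \<in> sets ?N"
        by (intro borel_measurable_le borel borel_measurable_proj)+
      show "{\<omega> \<in> space ?N.
        (fst (\<omega> (fst p)) \<le> fst (\<omega> (snd p)) \<longleftrightarrow> p \<in> A) \<and> (snd (\<omega> (fst p)) \<le> snd (\<omega> (snd p)) \<longleftrightarrow> p \<in> B)} \<in> sets ?N"
        using le by (cases "p \<in> A"; cases "p \<in> B") (simp_all add: sets.sets_Collect_conj sets.sets_Collect_neg)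
    qed simp
    finally show ?thesis .
  qed
  have "{\<omega> \<in> space ?N. PiSeq n \<omega> = y}
    = (\<Union>r \<in> {r \<in> Pow ?P \<times> Pow ?P. \<exists>\<omega>. R \<omega> = r \<and> PiSeq n \<omega> = y}. {\<omega> \<in> space ?N. R \<omega> = r})"
  proof (intro subset_antisym subsetI)
    fix \<omega> assume "\<omega> \<in> {\<omega> \<in> space ?N. PiSeq n \<omega> = y}"
    moreover have "R \<omega> \<in> Pow ?P \<times> Pow ?P" by (auto simp: R_def)
    ultimately show "\<omega> \<in> (\<Union>r \<in> {r \<in> Pow ?P \<times> Pow ?P. \<exists>\<omega>. R \<omega> = r \<and> PiSeq n \<omega> = y}. {\<omega> \<in> space ?N. R \<omega> = r})"
      by blast
  next
    fix \<omega> assume "\<omega> \<in> (\<Union>r \<in> {r \<in> Pow ?P \<times> Pow ?P. \<exists>\<omega>. R \<omega> = r \<and> PiSeq n \<omega> = y}. {\<omega> \<in> space ?N. R \<omega> = r})"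
    then obtain \<omega>' where "R \<omega>' = R \<omega>" "PiSeq n \<omega>' = y" "\<omega> \<in> space ?N" by auto
    with dep[of \<omega>' \<omega>] show "\<omega> \<in> {\<omega> \<in> space ?N. PiSeq n \<omega> = y}" by simp
  qed
  also have "\<dots> \<in> sets ?N"
    by (rule sets.finite_UN) (auto intro: meas)
  finally show ?thesis .
qed

lemma sets_PiSeq_iid [measurable]: "{\<omega>. PiSeq n \<omega> = y} \<in> sets M"
  using sets_PiSeq[of n UNIV y] by (simp add: iid_def space_PiM)

section \<open>Exchangeability, symmetric events and path probabilities\<close>

lemma distr_permute:
  assumes "bij g"
  shows "(\<lambda>\<omega>. \<omega> \<circ> g) \<in> measurable M M" "distr M M (\<lambda>\<omega>. \<omega> \<circ> g) = M"
proof -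
  show "(\<lambda>\<omega>. \<omega> \<circ> g) \<in> measurable M M"
    unfolding iid_def
    by (rule measurable_PiM_single') (auto simp: space_PiM)
  show "distr M M (\<lambda>\<omega>. \<omega> \<circ> g) = M"
    using distr_PiM_reindex[of UNIV "\<lambda>_. \<mu>" g UNIV] assms
    by (simp add: iid_def bij_is_inj comp_def restrict_def mu.prob_space_axioms)
qed

lemma measure_permute:
  assumes "g permutes S" "A \<in> sets M"
  shows "{\<omega>. \<omega> \<circ> g \<in> A} \<in> sets M" "measure M {\<omega>. \<omega> \<circ> g \<in> A} = measure M A"
proof -
  note d = distr_permute[OF permutes_bij[OF assms(1)]]
  have eq: "{\<omega>. \<omega> \<circ> g \<in> A} = (\<lambda>\<omega>. \<omega> \<circ> g) -` A \<inter> space M" by auto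
  show "{\<omega>. \<omega> \<circ> g \<in> A} \<in> sets M"
    unfolding eq using d(1) assms(2) by (rule measurable_sets)
  show "measure M {\<omega>. \<omega> \<circ> g \<in> A} = measure M A"
    unfolding eq using measure_distr[OF d(1) assms(2)] d(2) by simp
qed

text \<open>The first n coordinates of the infinite sample have the finite product as their law, and
  restricting to them does not change the pattern.\<close>

lemma t_cop_eq:
  assumes "y \<in> perms n" "n \<ge> 1"
  shows "t_cop \<mu> y = measure M {\<omega>. PiSeq n \<omega> = y}"
proof -
  let ?N = "PiM {..<n} (\<lambda>_. \<mu>)"
  let ?r = "\<lambda>\<omega>. \<lambda>k\<in>{..<n}. \<omega> k :: real \<times> real"
  have d: "distr M ?N ?r = ?N"
    using distr_PiM_reindex[of UNIV "\<lambda>_. \<mu>" id "{..<n}"] by (simp add: iid_def mu.prob_space_axioms)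
  have m: "?r \<in> measurable M ?N"
    unfolding iid_def by (rule measurable_restrict_subset) simp
  have "PiSeq n (?r \<omega>) = PiSeq n \<omega>" for \<omega>
  proof -
    have "inj_on (fst \<circ> ?r \<omega>) {..<n} \<longleftrightarrow> inj_on (fst \<circ> \<omega>) {..<n}"
      "inj_on (snd \<circ> ?r \<omega>) {..<n} \<longleftrightarrow> inj_on (snd \<circ> \<omega>) {..<n}"
      by (auto simp: inj_on_def)
    moreover have "pat (fst \<circ> ?r \<omega>) (snd \<circ> ?r \<omega>) (id ` {..<n}) = pat (fst \<circ> \<omega>) (snd \<circ> \<omega>) {..<n}"
      if "inj_on (fst \<circ> \<omega>) {..<n}" using that by (intro pat_image) auto
    ultimately show ?thesis by (simp add: PiSeq_pat_at pat_at_def)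
  qed
  then have "?r -` {\<omega> \<in> space ?N. PiSeq n \<omega> = y} \<inter> space M = {\<omega>. PiSeq n \<omega> = y}"
    by (auto simp: space_PiM)
  then have "measure ?N {\<omega> \<in> space ?N. PiSeq n \<omega> = y} = measure M {\<omega>. PiSeq n \<omega> = y}"
    using measure_distr[OF m sets_PiSeq[of n "{..<n}" y]] by (simp add: d)
  then show ?thesis
    using assms by (simp add: t_cop_def perms_length PiSeq_eq_iff)
qed

text \<open>The events \<open>PiSeq N \<omega> = y\<close> with N \<ge> n, and their finite
  intersections, are of this kind. They describe the present and future of the chain, so averaging
  over such events is what gives the Markov property.\<close>

definition symmetric :: "nat \<Rightarrow> (nat \<Rightarrow> real \<times> real) set \<Rightarrow> bool" where
  "symmetric n B \<longleftrightarrow> B \<in> sets M \<and> (\<forall>g \<omega>. g permutes {..<n} \<longrightarrow> (\<omega> \<circ> g \<in> B \<longleftrightarrow> \<omega> \<in> B))"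

lemma symmetric_Int_PiSeq: "symmetric n B \<Longrightarrow> symmetric n ({\<omega>. PiSeq n \<omega> = y} \<inter> B)"
  by (auto simp: symmetric_def PiSeq_permutes)

lemma symmetric_mono: "symmetric n B \<Longrightarrow> m \<le> n \<Longrightarrow> symmetric m B"
  unfolding symmetric_def by (meson lessThan_subset_iff permutes_subset)

lemma symmetric_UNIV: "symmetric n UNIV"
  using sets.top[of M] by (simp add: symmetric_def)

text \<open>By exchangeability the pattern of the first m points may be replaced by the pattern of
  any m of the n points; averaging over all choices turns it into a pattern frequency.\<close>
lemma prob_PiSeq_symmetric:
  assumes x: "x \<in> perms m" "1 \<le> m" and y: "y \<in> perms n" and mn: "m \<le> n" and B: "symmetric n B"
  shows "measure M ({\<omega>. PiSeq m \<omega> = x} \<inter> ({\<omega>. PiSeq n \<omega> = y} \<inter> B))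
    = t_perm x y * measure M ({\<omega>. PiSeq n \<omega> = y} \<inter> B)"
proof -
  define E where "E = {\<omega>. PiSeq n \<omega> = y} \<inter> B"
  have E: "symmetric n E" unfolding E_def using B by (rule symmetric_Int_PiSeq)
  then have Es [measurable]: "E \<in> sets M" by (simp add: symmetric_def)
  define A where "A J = {\<omega>. pat_at J \<omega> = x} \<inter> E" for J
  define Js where "Js = {J. J \<subseteq> {..<n} \<and> card J = m}"
  have fJ: "finite Js" unfolding Js_def by (rule finite_subset[of _ "Pow {..<n}"]) auto
  have A0: "A {..<m} = {\<omega>. PiSeq m \<omega> = x} \<inter> E" by (simp add: A_def PiSeq_pat_at)
  then have A0s: "A {..<m} \<in> sets M" by simp
  have AJ: "A J \<in> sets M" "measure M (A J) = measure M (A {..<m})" if "J \<in> Js" for J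
  proof -
    have "J \<subseteq> {..<n}" "card J = m" using that by (simp_all add: Js_def)
    then obtain g where g: "g permutes {..<n}" "g ` {..<m} = J"
      by (rule ex_permutes_image)
    have "\<omega> \<circ> g \<in> E \<longleftrightarrow> \<omega> \<in> E" "PiSeq m (\<omega> \<circ> g) = pat_at J \<omega>" for \<omega>
      using E g PiSeq_comp[OF permutes_inj_on[OF g(1)], of m \<omega>] by (auto simp: symmetric_def)
    \<comment> \<open>The relabelling g carries the first m points to J and leaves E invariant, so A
      J is the preimage of the event for the first m points and has the same probability.\<close>
    then have "A J = {\<omega>. \<omega> \<circ> g \<in> A {..<m}}"
      unfolding A0 A_def[of J] by (simp add: Collect_conj_eq)
    with measure_permute[OF g(1) A0s] show "A J \<in> sets M" "measure M (A J) = measure M (A {..<m})"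
      by simp_all
  qed
  have "real (n choose m) * measure M (A {..<m}) = (\<Sum>J\<in>Js. measure M (A J))"
    using AJ n_subsets[of "{..<n}" m] by (simp add: Js_def)
  also have "\<dots> = (\<Sum>J\<in>Js. \<integral>\<omega>. indicator (A J) \<omega> \<partial>M)"
    by simp
  also have "\<dots> = (\<integral>\<omega>. (\<Sum>J\<in>Js. indicator (A J) \<omega>) \<partial>M)"
    using AJ by (intro Bochner_Integration.integral_sum[symmetric]) (auto simp: M.emeasure_eq_measure)
  \<comment> \<open>On E the sum counts the m-subsets with pattern x, which is constant by
    \<open>card_pat_at\<close>; off E every term vanishes.\<close>
  also have "\<dots> = (\<integral>\<omega>. t_perm x y * real (n choose m) * indicator E \<omega> \<partial>M)"
  proof (rule Bochner_Integration.integral_cong)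
    fix \<omega>
    show "(\<Sum>J\<in>Js. indicator (A J) \<omega>) = t_perm x y * real (n choose m) * indicator E \<omega>"
    proof (cases "\<omega> \<in> E")
      case True
      then have "(\<Sum>J\<in>Js. indicator (A J) \<omega>) = real (card {J\<in>Js. pat_at J \<omega> = x})"
        using fJ by (simp add: A_def indicator_def sum.If_cases Int_def)
      also have "{J\<in>Js. pat_at J \<omega> = x} = {J. J \<subseteq> {..<n} \<and> card J = m \<and> pat_at J \<omega> = x}"
        by (auto simp: Js_def)
      finally show ?thesis
        using True card_pat_at[OF x y mn, of \<omega>] by (simp add: E_def)
    qed (simp add: A_def)
  qed simp
  also have "\<dots> = real (n choose m) * (t_perm x y * measure M E)" by simp
  finally have "measure M (A {..<m}) = t_perm x y * measure M E" using mn by simp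
  then show ?thesis by (simp add: A0 E_def)
qed

text \<open>By induction on n for all B at once: the condition at time \<open>Suc n\<close> is
  absorbed into the symmetric event of the induction hypothesis, and
  \<open>prob_PiSeq_symmetric\<close> then splits off the last pattern frequency.\<close>

lemma prob_path_symmetric:
  assumes "n \<ge> 1" "\<And>k. k \<in> {1..n} \<Longrightarrow> s k \<in> perms k" "symmetric n B"
  shows "measure M ({\<omega>. \<forall>k\<in>{1..n}. PiSeq k \<omega> = s k} \<inter> B)
    = (\<Prod>k\<in>{1..<n}. t_perm (s k) (s (Suc k))) * measure M ({\<omega>. PiSeq n \<omega> = s n} \<inter> B)"
  using assms
proof (induction n arbitrary: B rule: dec_induct)
  case base
  then show ?case by simp
next
  case (step n)
  let ?B = "{\<omega>. PiSeq (Suc n) \<omega> = s (Suc n)} \<inter> B"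
  have B: "symmetric (Suc n) B" by fact
  have "symmetric n ?B"
    using symmetric_mono[OF symmetric_Int_PiSeq[OF B]] by simp
  moreover have "{\<omega>. \<forall>k\<in>{1..Suc n}. PiSeq k \<omega> = s k} \<inter> B = {\<omega>. \<forall>k\<in>{1..n}. PiSeq k \<omega> = s k} \<inter> ?B"
    using step.hyps by (auto simp: atLeastAtMostSuc_conv)
  ultimately have "measure M ({\<omega>. \<forall>k\<in>{1..Suc n}. PiSeq k \<omega> = s k} \<inter> B)
    = (\<Prod>k\<in>{1..<n}. t_perm (s k) (s (Suc k))) * measure M ({\<omega>. PiSeq n \<omega> = s n} \<inter> ?B)"
    using step by simp
  also have "measure M ({\<omega>. PiSeq n \<omega> = s n} \<inter> ?B)
    = t_perm (s n) (s (Suc n)) * measure M ?B"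
    using step.hyps step.prems by (intro prob_PiSeq_symmetric) auto
  finally show ?case using step.hyps by (simp add: prod.atLeastLessThan_Suc mult_ac)
qed

section \<open>Ties have probability zero\<close>

lemma prob_two_points:
  assumes "i \<noteq> j" "A \<in> sets borel" "B \<in> sets borel"
  shows "measure M {\<omega>. \<omega> i \<in> A \<and> \<omega> j \<in> B} = measure \<mu> A * measure \<mu> B"
proof -
  have "{x \<in> space (PiM UNIV (\<lambda>_. \<mu>)). \<forall>l\<in>{i, j}. x l \<in> (if l = i then A else B)} = {\<omega>. \<omega> i \<in> A \<and> \<omega> j \<in> B}"
    using assms(1) by (auto simp: space_PiM)
  then have "emeasure M {\<omega>. \<omega> i \<in> A \<and> \<omega> j \<in> B} = emeasure \<mu> A * emeasure \<mu> B"
    using S.emeasure_PiM_Collect[of "{i, j}" "\<lambda>l. if l = i then A else B"] assms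
    by (simp add: iid_def sets_mu)
  then show ?thesis by (simp add: measure_def enn2real_mult)
qed

lemma sets_point: "A \<in> sets borel \<Longrightarrow> {\<omega>. \<omega> i \<in> A} \<in> sets M"
proof -
  assume "A \<in> sets borel"
  then have "(\<lambda>\<omega>. \<omega> i) -` A \<inter> space M \<in> sets M"
    unfolding iid_def by (intro measurable_sets[OF measurable_component_singleton]) (auto simp: sets_mu)
  then show ?thesis by (simp add: vimage_def)
qed

text \<open>Up to a null set, a tie puts both values into the same one of N cells of probability
  1/N. By independence this has probability at most N (1/N)^2 = 1/N, and N is arbitrary.\<close>

lemma prob_tie_zero:
  fixes h :: "real \<times> real \<Rightarrow> real"
  assumes ij: "i \<noteq> j" and h: "h \<in> borel_measurable borel"
    and unif: "\<And>x. x \<in> {0..1} \<Longrightarrow> measure \<mu> {p. h p \<le> x} = x"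
  shows "measure M {\<omega>. h (\<omega> i) = h (\<omega> j)} = 0"
proof -
  let ?E = "{\<omega>. h (\<omega> i) = h (\<omega> j)}"
  have sets_le: "{p. h p \<le> x} \<in> sets \<mu>" for x
    using measurable_sets[OF h, of "{..x}"] by (simp add: sets_mu vimage_def)
  \<comment> \<open>The values outside (0,1], which the half-open cells \<open>A k\<close> for k < N
    do not cover.\<close>
  define Z where "Z = {p. h p \<le> 0} \<union> (UNIV - {p. h p \<le> 1})"
  have Zs: "Z \<in> sets \<mu>" unfolding Z_def using sets_le sets.top[of \<mu>] by auto
  have "measure \<mu> Z \<le> measure \<mu> {p. h p \<le> 0} + measure \<mu> (space \<mu> - {p. h p \<le> 1})"
    unfolding Z_def space_mu[symmetric] using sets_le by (intro measure_Un_le) auto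
  also have "\<dots> = 0" using unif[of 0] unif[of 1] mu.prob_compl[OF sets_le[of 1]] by simp
  finally have Z0: "measure \<mu> Z = 0" by (simp add: measure_le_0_iff)
  have bound: "measure M ?E \<le> 1 / real N" if N: "N \<ge> 1" for N :: nat
  proof -
    define A where "A k = {p. h p \<le> real (Suc k) / real N} - {p. h p \<le> real k / real N}" for k
    have As: "A k \<in> sets \<mu>" for k unfolding A_def using sets_le by auto
    have A: "measure \<mu> (A k) = 1 / real N" if "k < N" for k
    proof -
      have "measure \<mu> (A k) = measure \<mu> {p. h p \<le> real (Suc k) / real N} - measure \<mu> {p. h p \<le> real k / real N}"
        unfolding A_def using N
        by (intro mu.finite_measure_Diff sets_le) (auto elim!: order_trans intro!: divide_right_mono)
      also have "\<dots> = real (Suc k) / real N - real k / real N"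
        using that by (subst (1 2) unif) auto
      finally show ?thesis by (simp add: diff_divide_distrib[symmetric])
    qed
    have two: "{\<omega>. \<omega> i \<in> A k \<and> \<omega> j \<in> A k} \<in> sets M" for k
      using sets.Int[OF sets_point[of "A k" i] sets_point[of "A k" j]] As[of k] by (simp add: sets_mu Collect_conj_eq)
    have "?E \<subseteq> (\<Union>k<N. {\<omega>. \<omega> i \<in> A k \<and> \<omega> j \<in> A k}) \<union> {\<omega>. \<omega> i \<in> Z \<and> \<omega> j \<in> UNIV}"
    proof
      fix \<omega> assume eq: "\<omega> \<in> ?E"
      define v where "v = h (\<omega> i)"
      show "\<omega> \<in> (\<Union>k<N. {\<omega>. \<omega> i \<in> A k \<and> \<omega> j \<in> A k}) \<union> {\<omega>. \<omega> i \<in> Z \<and> \<omega> j \<in> UNIV}"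
      proof (cases "0 < v \<and> v \<le> 1")
        case True
        \<comment> \<open>The cells are open on the left and closed on the right, so the index is
          the ceiling minus one and not the floor.\<close>
        define k where "k = nat (\<lceil>v * real N\<rceil> - 1)"
        have pos: "0 < v * real N" using True N by simp
        then have k: "real k < v * real N" "v * real N \<le> real (Suc k)" unfolding k_def by linarith+
        moreover have "v * real N \<le> real N" using True N by (simp add: mult_left_le_one_le)
        ultimately have "k < N" by linarith
        moreover have "\<omega> i \<in> A k" "\<omega> j \<in> A k"
          using k N eq by (auto simp: A_def v_def field_simps)
        ultimately show ?thesis by blast
      qed (auto simp: Z_def v_def)
    qed
    then have "measure M ?E \<le> measure M ((\<Union>k<N. {\<omega>. \<omega> i \<in> A k \<and> \<omega> j \<in> A k}) \<union> {\<omega>. \<omega> i \<in> Z \<and> \<omega> j \<in> UNIV})"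
      using two sets_point[of Z i] Zs by (intro M.finite_measure_mono) (auto simp: sets_mu)
    also have "\<dots> \<le> measure M (\<Union>k<N. {\<omega>. \<omega> i \<in> A k \<and> \<omega> j \<in> A k}) + measure M {\<omega>. \<omega> i \<in> Z \<and> \<omega> j \<in> UNIV}"
      using two sets_point[of Z i] Zs by (intro measure_Un_le) (auto simp: sets_mu)
    also have "measure M {\<omega>. \<omega> i \<in> Z \<and> \<omega> j \<in> UNIV} = 0"
      using prob_two_points[OF ij, of Z UNIV] Zs Z0 by (simp add: sets_mu)
    also have "measure M (\<Union>k<N. {\<omega>. \<omega> i \<in> A k \<and> \<omega> j \<in> A k}) \<le> (\<Sum>k<N. measure M {\<omega>. \<omega> i \<in> A k \<and> \<omega> j \<in> A k})"
      using two by (intro measure_UNION_le) auto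
    also have "\<dots> = (\<Sum>k<N. 1 / real N * (1 / real N))"
      using As A by (intro sum.cong) (auto simp: prob_two_points[OF ij] sets_mu)
    also have "\<dots> = 1 / real N" using N by simp
    finally show ?thesis by simp
  qed
  have "measure M ?E \<le> 1 / real (Suc N)" for N by (rule bound) simp
  then have "measure M ?E \<le> 0"
    using LIMSEQ_le_const[OF LIMSEQ_Suc[OF lim_1_over_n]] by blast
  then show ?thesis by (simp add: measure_le_0_iff)
qed

text \<open>Almost surely no two of the n points tie, so the default value is attained only on a
  null set. Hence a path of positive probability consists of genuine permutations.\<close>

lemma prob_PiSeq_Nil: "measure M {\<omega>. PiSeq n \<omega> = []} = 0" if "n \<ge> 1"
proof -
  have fst0: "measure M {\<omega>. fst (\<omega> i) = fst (\<omega> j)} = 0" if "i \<noteq> j" for i j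
  proof (rule prob_tie_zero[OF that borel_measurable_proj(1)])
    fix x :: real assume "x \<in> {0..1}"
    moreover have "{p :: real \<times> real. fst p \<le> x} = {..x} \<times> UNIV" by auto
    ultimately show "measure \<mu> {p. fst p \<le> x} = x" using copula by (simp add: copula_measure_def)
  qed
  have snd0: "measure M {\<omega>. snd (\<omega> i) = snd (\<omega> j)} = 0" if "i \<noteq> j" for i j
  proof (rule prob_tie_zero[OF that borel_measurable_proj(2)])
    fix x :: real assume "x \<in> {0..1}"
    moreover have "{p :: real \<times> real. snd p \<le> x} = UNIV \<times> {..x}" by auto
    ultimately show "measure \<mu> {p. snd p \<le> x} = x" using copula by (simp add: copula_measure_def)
  qed
  have sets_tie: "{\<omega>. h (\<omega> i) = h (\<omega> j)} \<in> sets M"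
    if "h \<in> borel_measurable borel" for h :: "real \<times> real \<Rightarrow> real" and i j
  proof -
    have "(\<lambda>\<omega>. \<omega> l) \<in> measurable M borel" for l
      unfolding iid_def by (auto intro!: measurable_component_singleton simp flip: measurable_cong_sets[OF refl sets_mu])
    note measurable_compose[OF this that]
    then have "{\<omega> \<in> space M. h (\<omega> i) = h (\<omega> j)} \<in> sets M" by (intro borel_measurable_eq)
    then show ?thesis by simp
  qed
  have AE_fst: "AE \<omega> in M. fst (\<omega> i) \<noteq> fst (\<omega> j)" and AE_snd: "AE \<omega> in M. snd (\<omega> i) \<noteq> snd (\<omega> j)"
    if "i \<noteq> j" for i j
    using fst0[OF that] snd0[OF that] sets_tie[OF borel_measurable_proj(1), of i j]
      sets_tie[OF borel_measurable_proj(2), of i j]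
    by (auto simp: M.prob_eq_0)
  have "AE \<omega> in M. \<forall>i\<in>{..<n}. \<forall>j\<in>{..<n}. i \<noteq> j \<longrightarrow> fst (\<omega> i) \<noteq> fst (\<omega> j) \<and> snd (\<omega> i) \<noteq> snd (\<omega> j)"
    using AE_fst AE_snd by (intro AE_finite_allI AE_impI AE_conjI) auto
  then have "AE \<omega> in M. \<omega> \<notin> {\<omega>. PiSeq n \<omega> = []}"
  proof eventually_elim
    case (elim \<omega>)
    then have "no_ties n \<omega>" by (auto simp: no_ties_def inj_on_def)
    then show ?case using perms_not_Nil[OF PiSeq_perms that] by simp
  qed
  then show ?thesis using sets_PiSeq_iid[of n "[]"] by (simp add: M.prob_eq_0)
qed

section \<open>Transition probabilities and Doob-Martin functions of the permutation
  sequence\<close>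

lemma probPi_eq:
  assumes "y \<in> perms n" "n \<ge> 1"
  shows "probPi \<mu> y = t_cop \<mu> y"
  using assms by (simp add: probPi_def t_cop_eq perms_length)

lemma probPi2_eq:
  assumes "x \<in> perms m" "m \<ge> 1" "y \<in> perms n" "m \<le> n"
  shows "probPi2 \<mu> x y = t_perm x y * t_cop \<mu> y"
  using prob_PiSeq_symmetric[OF assms symmetric_UNIV] assms
  by (simp add: probPi2_def t_cop_eq perms_length Collect_conj_eq)

text \<open>The factor t(y, C) in the joint probability cancels because it is positive on the state
  space; if x is longer than y, both sides are 0 by definition.\<close>

lemma fDM_eq:
  assumes "x \<in> allperms" "y \<in> state_space \<mu>"
  shows "fDM \<mu> x y = t_perm x y"
proof -
  obtain m n where xy: "x \<in> perms m" "m \<ge> 1" "y \<in> perms n" "n \<ge> 1"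
    using assms by (auto simp: allperms_def state_space_def)
  then show ?thesis
    using assms(2) probPi_eq[OF xy(3,4)] probPi2_eq[OF xy(1-3)]
    by (auto simp: fDM_def perms_length state_space_def t_perm_def)
qed

text \<open>The joint event for x and y has probability t(x, y) t(y, C) and lies in the null event
  for x, while t(y, C) is positive. Thus the functions that only the pattern frequency topology uses
  vanish on the state space.\<close>

lemma t_perm_eq_0:
  assumes x: "x \<in> allperms" "x \<notin> state_space \<mu>" and y: "y \<in> state_space \<mu>"
  shows "t_perm x y = 0"
proof -
  obtain m n where xy: "x \<in> perms m" "m \<ge> 1" "y \<in> perms n" "n \<ge> 1"
    using assms by (auto simp: allperms_def state_space_def)
  show ?thesis
  proof (cases "m \<le> n")
    case True
    have "probPi2 \<mu> x y \<le> probPi \<mu> x"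
      unfolding probPi2_def probPi_def by (rule M.finite_measure_mono) auto
    also have "\<dots> \<le> 0" using x by (simp add: probPi_eq[OF xy(1,2)] state_space_def)
    finally have "t_perm x y * t_cop \<mu> y \<le> 0" using probPi2_eq[OF xy(1-3) True] by simp
    moreover have "t_cop \<mu> y > 0" using y by (simp add: state_space_def)
    moreover have "t_perm x y \<ge> 0" by (simp add: t_perm_def)
    ultimately show ?thesis by (simp add: mult_le_0_iff)
  qed (use xy in \<open>simp add: t_perm_def perms_length\<close>)
qed

lemma transPi_eq:
  assumes "\<sigma> \<in> perms n" "n \<ge> 1" "\<tau> \<in> perms (n + 1)"
  shows "transPi \<mu> \<sigma> \<tau> = real (n + 1) * t_cop \<mu> \<tau> / t_cop \<mu> \<sigma> * pH \<sigma> \<tau>"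
  using probPi_eq[OF assms(1,2)] probPi2_eq[OF assms] pH_eq[of \<sigma> n \<tau>] assms
  by (simp add: transPi_def)

text \<open>The product of pattern frequencies along the path occurs in numerator and denominator
  and cancels, leaving an expression in the last state alone. Positivity of the path probability
  makes both cancelled and remaining denominators nonzero.\<close>

lemma path_transition:
  assumes n: "n \<ge> 1" and \<tau>: "\<tau> \<in> perms (n + 1)"
    and pos: "measure M {\<omega>. \<forall>k\<in>{1..n}. PiSeq k \<omega> = s k} > 0"
  shows "measure M {\<omega>. (\<forall>k\<in>{1..n}. PiSeq k \<omega> = s k) \<and> PiSeq (n + 1) \<omega> = \<tau>}
      / measure M {\<omega>. \<forall>k\<in>{1..n}. PiSeq k \<omega> = s k}
    = real (n + 1) * t_cop \<mu> \<tau> / t_cop \<mu> (s n) * pH (s n) \<tau>"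
proof -
  let ?A = "{\<omega>. \<forall>k\<in>{1..n}. PiSeq k \<omega> = s k}"
  \<comment> \<open>The states s k are arbitrary lists; positive probability excludes the value
    \<open>[]\<close>, and every other value of \<open>PiSeq k\<close> is a permutation.\<close>
  have s: "s k \<in> perms k" if k: "k \<in> {1..n}" for k
  proof -
    have "s k \<noteq> []"
    proof
      assume "s k = []"
      then have "measure M ?A \<le> measure M {\<omega>. PiSeq k \<omega> = []}"
        using k by (intro M.finite_measure_mono) auto
      with pos prob_PiSeq_Nil[of k] k show False by simp
    qed
    moreover have "?A \<noteq> {}" using pos measure_empty[of M] by (metis less_irrefl)
    then obtain \<omega> where "PiSeq k \<omega> = s k" using k by blast
    ultimately show ?thesis using PiSeq_perms[of k \<omega>] by (auto simp: PiSeq_def split: if_splits)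
  qed
  define c where "c = (\<Prod>k\<in>{1..<n}. t_perm (s k) (s (Suc k)))"
  have sn: "s n \<in> perms n" using s n by simp
  have A: "measure M ?A = c * t_cop \<mu> (s n)"
    using prob_path_symmetric[OF n s symmetric_UNIV] by (simp add: c_def t_cop_eq[OF sn n])
  have "{\<omega>. (\<forall>k\<in>{1..n}. PiSeq k \<omega> = s k) \<and> PiSeq (n + 1) \<omega> = \<tau>} = ?A \<inter> {\<omega>. PiSeq (Suc n) \<omega> = \<tau>}"
    by auto
  \<comment> \<open>Permuting only the first n points does not change the pattern of all n + 1, so
    the next state may play the part of B.\<close>
  moreover have "symmetric n {\<omega>. PiSeq (Suc n) \<omega> = \<tau>}"
    using symmetric_mono[OF symmetric_Int_PiSeq[OF symmetric_UNIV], of n "Suc n" \<tau>] by simp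
  ultimately have "measure M {\<omega>. (\<forall>k\<in>{1..n}. PiSeq k \<omega> = s k) \<and> PiSeq (n + 1) \<omega> = \<tau>}
    = c * measure M ({\<omega>. PiSeq n \<omega> = s n} \<inter> {\<omega>. PiSeq (Suc n) \<omega> = \<tau>})"
    using prob_path_symmetric[OF n s] by (simp add: c_def)
  also have "\<dots> = c * (t_perm (s n) \<tau> * t_cop \<mu> \<tau>)"
    using prob_PiSeq_symmetric[OF sn n, of \<tau> "Suc n", OF _ _ symmetric_UNIV] \<tau> t_cop_eq[of \<tau> "Suc n"] by simp
  finally show ?thesis
    using pos A pH_eq[OF sn, of \<tau>] \<tau> by (auto simp: zero_less_mult_iff)
qed

end

theorem theorem4:
  fixes C :: "real \<Rightarrow> real \<Rightarrow> real" and \<mu> :: "(real \<times> real) measure"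
  assumes cop: "copula_measure \<mu>"
    and cdf: "\<forall>u v. C u v = measure \<mu> ({..u} \<times> {..v})"
  shows
    \<comment> \<open>(i) Markov property with the given transition probabilities\<close>
    "(\<forall>n\<ge>1. \<forall>s :: nat \<Rightarrow> nat list. \<forall>\<tau>\<in>perms (n + 1).
        measure (iid \<mu>) {\<omega> \<in> space (iid \<mu>). \<forall>k\<in>{1..n}. PiSeq k \<omega> = s k} > 0 \<longrightarrow>
        measure (iid \<mu>) {\<omega> \<in> space (iid \<mu>). (\<forall>k\<in>{1..n}. PiSeq k \<omega> = s k) \<and> PiSeq (n + 1) \<omega> = \<tau>}
          / measure (iid \<mu>) {\<omega> \<in> space (iid \<mu>). \<forall>k\<in>{1..n}. PiSeq k \<omega> = s k}
        = real (n + 1) * t_cop \<mu> \<tau> / t_cop \<mu> (s n) * pH (s n) \<tau>)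
   \<and> (\<forall>n\<ge>1. \<forall>\<sigma>\<in>perms n \<inter> state_space \<mu>. \<forall>\<tau>\<in>perms (n + 1).
        transPi \<mu> \<sigma> \<tau> = real (n + 1) * t_cop \<mu> \<tau> / t_cop \<mu> \<sigma> * pH \<sigma> \<tau>)
    \<comment> \<open>(ii) Doob--Martin topology = pattern frequency topology on S_C\<close>
   \<and> (\<forall>y :: nat \<Rightarrow> nat list. (\<forall>k. y k \<in> state_space \<mu>) \<longrightarrow>
        ((\<forall>x\<in>state_space \<mu>. convergent (\<lambda>k. fDM \<mu> x (y k)))
         \<longleftrightarrow> (\<forall>\<sigma>\<in>allperms. convergent (\<lambda>k. t_perm \<sigma> (y k)))))
    \<comment> \<open>(iii) Doob h-transform of Pi^H via the extended Martin kernel K(., C)\<close>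
   \<and> (\<exists>KC :: nat list \<Rightarrow> real.
        (\<forall>\<sigma>\<in>allperms. \<forall>y :: nat \<Rightarrow> nat list.
           (\<forall>k. y k \<in> allperms) \<and> (\<forall>\<rho>\<in>allperms. (\<lambda>k. t_perm \<rho> (y k)) \<longlonglongrightarrow> t_cop \<mu> \<rho>)
           \<longrightarrow> (\<lambda>k. KH \<sigma> (y k)) \<longlonglongrightarrow> KC \<sigma>)
      \<and> (\<forall>n\<ge>1. \<forall>\<sigma>\<in>perms n \<inter> state_space \<mu>. \<forall>\<tau>\<in>perms (n + 1).
           transPi \<mu> \<sigma> \<tau> = KC \<tau> / KC \<sigma> * pH \<sigma> \<tau>))"
proof -
  interpret copula_sample \<mu> using cop by unfold_locales
  show ?thesis
  proof (intro conjI)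
    show "\<forall>n\<ge>1. \<forall>s :: nat \<Rightarrow> nat list. \<forall>\<tau>\<in>perms (n + 1).
        measure M {\<omega> \<in> space M. \<forall>k\<in>{1..n}. PiSeq k \<omega> = s k} > 0 \<longrightarrow>
        measure M {\<omega> \<in> space M. (\<forall>k\<in>{1..n}. PiSeq k \<omega> = s k) \<and> PiSeq (n + 1) \<omega> = \<tau>}
          / measure M {\<omega> \<in> space M. \<forall>k\<in>{1..n}. PiSeq k \<omega> = s k}
        = real (n + 1) * t_cop \<mu> \<tau> / t_cop \<mu> (s n) * pH (s n) \<tau>"
      using path_transition by simp
  next
    show "\<forall>n\<ge>1. \<forall>\<sigma>\<in>perms n \<inter> state_space \<mu>. \<forall>\<tau>\<in>perms (n + 1).
        transPi \<mu> \<sigma> \<tau> = real (n + 1) * t_cop \<mu> \<tau> / t_cop \<mu> \<sigma> * pH \<sigma> \<tau>"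
      using transPi_eq by blast
  next
    show "\<forall>y :: nat \<Rightarrow> nat list. (\<forall>k. y k \<in> state_space \<mu>) \<longrightarrow>
        ((\<forall>x\<in>state_space \<mu>. convergent (\<lambda>k. fDM \<mu> x (y k)))
         \<longleftrightarrow> (\<forall>\<sigma>\<in>allperms. convergent (\<lambda>k. t_perm \<sigma> (y k))))"
    proof (intro allI impI)
      fix y :: "nat \<Rightarrow> nat list" assume y: "\<forall>k. y k \<in> state_space \<mu>"
      have S: "state_space \<mu> \<subseteq> allperms" by (auto simp: state_space_def)
      \<comment> \<open>The extra patterns give constant zero sequences.\<close>
      have "convergent (\<lambda>k. t_perm \<sigma> (y k))" if "\<sigma> \<in> allperms" "\<sigma> \<notin> state_space \<mu>" for \<sigma>
        using t_perm_eq_0[OF that] y by (simp add: convergent_const)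
      moreover have "fDM \<mu> x (y k) = t_perm x (y k)" if "x \<in> state_space \<mu>" for x k
        using fDM_eq that S y by blast
      ultimately show "(\<forall>x\<in>state_space \<mu>. convergent (\<lambda>k. fDM \<mu> x (y k)))
         \<longleftrightarrow> (\<forall>\<sigma>\<in>allperms. convergent (\<lambda>k. t_perm \<sigma> (y k)))"
        using S by auto
    qed
  next
    \<comment> \<open>The kernel at y is m! t(\<sigma>, y) with m the length of \<sigma>, so its
      limit as y tends to C has to be m! t(\<sigma>, C).\<close>
    let ?KC = "\<lambda>\<sigma>. fact (length \<sigma>) * t_cop \<mu> \<sigma>"
    have "(\<lambda>k. KH \<sigma> (y k)) \<longlonglongrightarrow> ?KC \<sigma>"
      if "\<sigma> \<in> allperms" "\<forall>k. y k \<in> allperms" "\<forall>\<rho>\<in>allperms. (\<lambda>k. t_perm \<rho> (y k)) \<longlonglongrightarrow> t_cop \<mu> \<rho>" for \<sigma> y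
    proof -
      obtain m where m: "\<sigma> \<in> perms m" "m \<ge> 1" using \<open>\<sigma> \<in> allperms\<close> unfolding allperms_def by blast
      have "KH \<sigma> (y k) = fact (length \<sigma>) * t_perm \<sigma> (y k)" for k
        using KH_eq[OF m(1) _ m(2)] that(2) by (simp add: perms_length[OF m(1)])
      then show ?thesis using that by (auto intro: tendsto_mult_left)
    qed
    \<comment> \<open>The factor n + 1 of \<open>transPi_eq\<close> is the quotient (n+1)!/n! of the
      factorials in the two kernel values.\<close>
    moreover have "transPi \<mu> \<sigma> \<tau> = ?KC \<tau> / ?KC \<sigma> * pH \<sigma> \<tau>"
      if "n \<ge> 1" "\<sigma> \<in> perms n" "\<tau> \<in> perms (n + 1)" for n \<sigma> \<tau>
      using transPi_eq[OF that(2,1,3)] that by (simp add: perms_length mult_ac)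
    ultimately show "\<exists>KC :: nat list \<Rightarrow> real.
        (\<forall>\<sigma>\<in>allperms. \<forall>y :: nat \<Rightarrow> nat list.
           (\<forall>k. y k \<in> allperms) \<and> (\<forall>\<rho>\<in>allperms. (\<lambda>k. t_perm \<rho> (y k)) \<longlonglongrightarrow> t_cop \<mu> \<rho>)
           \<longrightarrow> (\<lambda>k. KH \<sigma> (y k)) \<longlonglongrightarrow> KC \<sigma>)
      \<and> (\<forall>n\<ge>1. \<forall>\<sigma>\<in>perms n \<inter> state_space \<mu>. \<forall>\<tau>\<in>perms (n + 1).
           transPi \<mu> \<sigma> \<tau> = KC \<tau> / KC \<sigma> * pH \<sigma> \<tau>)"
      by (intro exI[of _ ?KC]) blast
  qed
qed

end
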